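(* Let $k \geq 4$ and let $\mathbb{A} = \{a_0, a_1, \ldots, a_{k-1}\}_{\vec r}$ be a sequence of nonnegative integers with $0 = a_0 < a_1 < \cdots < a_{k-1}$, $\vec r = (r_0, r_1, \ldots, r_{k-1})$ and $r_i \geq 1$ for all $i \in [0,k-1]$. Let $A = \{a_0,\ldots,a_{k-1}\}$ with $d(A) = 1$, and suppose $r = \min\{r_1, \ldots, r_{k-1}\} \geq 2$. Let $\alpha < \sum_{i=0}^{k-1} r_i - 2$ be a positive integer. Then: (1) If $0 < \alpha < \sum_{i=0}^{k-1} r_i - r$, then there exists an integer $m \in [1,k]$ such that $\sum_{i=0}^{m-2} r_i \leq \alpha < \sum_{i=0}^{m-1} r_i$ and \[ |S_\alpha(\mathbb{A})| \geq |(r-1)A| + \min\{a_{k-1}, r(k-2)+1\} + \sum_{i=1}^{k-1}(i-1) r_{i-1} - \sum_{i=1}^m (i-1) r_{i-1} + (m-1)\Big(\sum_{i=1}^m r_{i-1} - \alpha\Big) + (k-1)(r_{k-1} - r). \] (2) If $\sum_{i=0}^{k-1} r_i - r \leq \alpha < \sum_{i=0}^{k-1} r_i - 2$, then \[ |S_\alpha(\mathbb{A})| \geq \begin{cases} a_{k-1} - k + 2 + (k-1)\Big(\sum_{i=1}^k r_{i-1} - \alpha\Big) & \text{if } a_{k-1} \leq 2k-3,\\ k - 1 + (k-1)\Big(\sum_{i=1}^k r_{i-1} - \alpha\Big) & \text{if } a_{k-1} \geq 2k-2. \end{cases} \]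
   Context: The notation $\mathbb{A} = \{a_0, \ldots, a_{k-1}\}_{\vec r}$ with $\vec r = (r_0,\ldots,r_{k-1})$ means $\mathbb{A}$ is a finite sequence consisting of the $k$ distinct integers $a_0,\ldots,a_{k-1}$, where $a_i$ appears exactly $r_i$ times. For a positive integer $\alpha$, $S_\alpha(\mathbb{A}) = \{\sum_{b\in\mathbb{B}} b : \mathbb{B} \text{ a subsequence of } \mathbb{A},\ |\mathbb{B}| \geq \alpha\}$, where $|\mathbb{B}|$ counts terms with multiplicity. For a finite set $X$ of integers and $h \ge 1$, $hX$ is the $h$-fold sumset (all sums of $h$ not necessarily distinct elements of $X$). $d(A)$ is the gcd of the elements of $A$. Empty sums are $0$. *)

theory Defs
  imports Complex_Main "HOL-Library.Multiset"
begin

text \<open>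
  The finite sequences are determined by the multiplicities of their terms, and only sums and
  lengths of subsequences are used; so sequences are multisets and subsequences are
  sub-multisets.
\<close>

definition seq_of :: "nat \<Rightarrow> (nat \<Rightarrow> int) \<Rightarrow> (nat \<Rightarrow> nat) \<Rightarrow> int multiset" where
  "seq_of k a r = (\<Sum>i<k. replicate_mset (r i) (a i))"

definition subseq_sums :: "nat \<Rightarrow> int multiset \<Rightarrow> int set" where
  "subseq_sums \<alpha> \<A> = {\<Sum>\<^sub># \<B> | \<B>. \<B> \<subseteq># \<A> \<and> \<alpha> \<le> size \<B>}"

definition sumset_fold :: "nat \<Rightarrow> int set \<Rightarrow> int set" where
  "sumset_fold h X = {\<Sum>\<^sub># \<B> | \<B>. set_mset \<B> \<subseteq> X \<and> size \<B> = h}"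

end

theory Submission
  imports Defs
begin

text \<open>
  Replacing a subsequence by its complement, \<open>|S\<^sub>\<alpha>|\<close> is the number of sums of at most
  \<open>L = \<Sum>r\<^sub>i - \<alpha>\<close> terms. If \<open>L \<le> r\<close>, these include \<open>LA\<close>; if \<open>L > r\<close>, they include \<open>rA\<close>, and adding
  the largest remaining term of the sequence one at a time produces \<open>i\<close> new sums above all
  previous ones whenever that term is \<open>a\<^sub>i\<close>. Both parts thus reduce to Lev's theorem
  \<open>|hA| \<ge> |(h-1)A| + min {n, h(k-2)+1}\<close>, where \<open>n = a\<^sub>k\<^sub>-\<^sub>1\<close>.

  For Lev's theorem, every residue class modulo \<open>n\<close> met by \<open>hA\<close> contains an element of
  \<open>hA - (h-1)A\<close>. Hamidoune's atom argument in \<open>\<int>/n\<close> yields a divisor \<open>g\<close> of \<open>n\<close> such that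
  \<open>T + A\<close> is everything or has at least \<open>|T| + u - 1\<close> elements for all nonempty \<open>T \<subseteq> \<int>/g\<close>, where
  \<open>u = |A mod g|\<close>, and such that \<open>A\<close> nearly fills its \<open>u\<close> classes modulo \<open>g\<close>. By the pigeonhole
  principle \<open>hA\<close> then fills its classes modulo \<open>g\<close>, with at most one (bad) exception, and the
  missing elements are recovered from a class modulo \<open>g\<close> which \<open>(h-1)A\<close> does not meet: there the
  integer bound \<open>|X + Y| \<ge> |X| + |Y| - 1\<close> applies.
\<close>

section \<open>An isoperimetric inequality modulo n\<close>

abbreviation residues_mod :: "int \<Rightarrow> int set \<Rightarrow> int set" where
  "residues_mod n X \<equiv> (\<lambda>x. x mod n) ` X"

text \<open>Residues modulo \<open>n\<close> are integers in \<open>{0..<n}\<close>. The summands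
  may be arbitrary integers, so one set \<open>S\<close> serves for \<open>n\<close> and for its
  divisors.\<close>

definition mod_sumset :: "int \<Rightarrow> int set \<Rightarrow> int set \<Rightarrow> int set" where
  "mod_sumset n X Y = (\<lambda>(x, y). (x + y) mod n) ` (X \<times> Y)"

lemma mod_sumsetI: "x \<in> X \<Longrightarrow> y \<in> Y \<Longrightarrow> z = (x + y) mod n \<Longrightarrow> z \<in> mod_sumset n X Y"
  unfolding mod_sumset_def by force

lemma mod_sumsetE:
  assumes "z \<in> mod_sumset n X Y"
  obtains x y where "x \<in> X" "y \<in> Y" "z = (x + y) mod n"
  using assms unfolding mod_sumset_def by auto

lemma mod_sumset_subset: "n > 0 \<Longrightarrow> mod_sumset n X Y \<subseteq> {0..<n}"
  unfolding mod_sumset_def by auto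

lemma residues_mod_subset: "n > 0 \<Longrightarrow> residues_mod n X \<subseteq> {0..<n}"
  by auto

lemma finite_residues_mod: "n > 0 \<Longrightarrow> finite (residues_mod n X)"
  by (rule finite_subset[OF residues_mod_subset finite_atLeastLessThan_int])

lemma finite_mod_sumset: "n > 0 \<Longrightarrow> finite (mod_sumset n X Y)"
  by (rule finite_subset[OF mod_sumset_subset finite_atLeastLessThan_int])

lemma inj_on_translate_mod: "inj_on (\<lambda>x. (x + t) mod n) {0..<n :: int}"
proof (rule inj_onI)
  fix x y assume xy: "x \<in> {0..<n}" "y \<in> {0..<n}" "(x + t) mod n = (y + t) mod n"
  then have "x mod n = y mod n"
    unfolding mod_eq_dvd_iff by simp
  then show "x = y" using xy by simp
qed

lemma inj_on_uminus_mod: "inj_on (\<lambda>x. (- x) mod n) {0..<n :: int}"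
proof (rule inj_onI)
  fix x y assume xy: "x \<in> {0..<n}" "y \<in> {0..<n}" "(- x) mod n = (- y) mod n"
  then have "x mod n = y mod n"
    by (metis minus_minus mod_minus_eq)
  then show "x = y" using xy by simp
qed

lemma mod_sumset_translate:
  assumes "n > 0"
  shows "mod_sumset n ((\<lambda>x. (x + t) mod n) ` X) S = (\<lambda>x. (x + t) mod n) ` mod_sumset n X S"
proof -
  have *: "((x + t) mod n + s) mod n = ((x + s) mod n + t) mod n" for x s
    by (simp add: mod_simps algebra_simps)
  show ?thesis
    unfolding mod_sumset_def by (force simp: * image_iff)
qed

lemma mod_sumset_zero: "mod_sumset n {0} S = residues_mod n S"
  unfolding mod_sumset_def by force

text \<open>Among the sets \<open>X\<close> with \<open>X + S\<close> not everything, atoms are the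
  smallest ones that minimise \<open>|X + S| - |X|\<close>. Distinct atoms are disjoint and
  translates of atoms are atoms, so an atom containing 0 is a subgroup.\<close>

lemma isoperimetric_subgroup:
  fixes n :: int and S :: "int set"
  assumes n: "n > 0" and S: "residues_mod n S \<noteq> {0..<n}"
  obtains H where "H \<subseteq> {0..<n}" "0 \<in> H"
    "\<And>x y. x \<in> H \<Longrightarrow> y \<in> H \<Longrightarrow> (x - y) mod n \<in> H"
    "mod_sumset n H S \<noteq> {0..<n}"
    "\<And>T. T \<subseteq> {0..<n} \<Longrightarrow> T \<noteq> {} \<Longrightarrow> mod_sumset n T S \<noteq> {0..<n} \<Longrightarrow>
       card T + card (mod_sumset n H S) \<le> card (mod_sumset n T S) + card H"
proof -
  define adm where "adm X \<longleftrightarrow> X \<subseteq> {0..<n} \<and> X \<noteq> {} \<and> mod_sumset n X S \<noteq> {0..<n}" for X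
  define f where "f X = int (card (mod_sumset n X S)) - int (card X)" for X
  define tr where "tr t X = (\<lambda>x. (x + t) mod n) ` X" for t X
  define F where "F = {X. adm X}"
  have finF: "finite F"
    unfolding F_def adm_def by (rule finite_subset[of _ "Pow {0..<n}"]) auto
  have "adm {0}" using n S by (simp add: adm_def mod_sumset_zero)
  then have F0: "F \<noteq> {}" by (auto simp: F_def)
  define \<kappa> where "\<kappa> = Min (f ` F)"
  have \<kappa>_le: "\<kappa> \<le> f X" if "adm X" for X
    unfolding \<kappa>_def using finF that by (auto simp: F_def)
  define atom where "atom X \<longleftrightarrow> adm X \<and> f X = \<kappa> \<and> (\<forall>Y. adm Y \<longrightarrow> f Y = \<kappa> \<longrightarrow> card X \<le> card Y)" for X
  have "\<kappa> \<in> f ` F" unfolding \<kappa>_def using finF F0 by simp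
  then obtain X1 where X1: "adm X1 \<and> f X1 = \<kappa>" by (auto simp: F_def)
  obtain X0 where "atom X0"
    using ex_has_least_nat[of "\<lambda>X. adm X \<and> f X = \<kappa>" X1 card, OF X1] unfolding atom_def by blast
  have sub: "mod_sumset n X S \<subseteq> {0..<n}" for X by (rule mod_sumset_subset[OF n])
  have fins: "finite (mod_sumset n X S)" for X by (rule finite_mod_sumset[OF n])
  have fina: "finite X" if "adm X" for X
    using that finite_subset unfolding adm_def by blast

  text \<open>The negated complement of \<open>X + S\<close> competes with \<open>X\<close>, so an atom is no larger than it.\<close>
  have dual: "card X + card (mod_sumset n X S) \<le> nat n" if "atom X" for X
  proof -
    let ?C = "{0..<n} - mod_sumset n X S"
    let ?Y = "(\<lambda>x. (- x) mod n) ` ?C"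
    have aX: "adm X" "f X = \<kappa>" using that by (auto simp: atom_def)
    have cardX: "card ((\<lambda>x. (- x) mod n) ` X) = card X"
      using aX inj_on_subset[OF inj_on_uminus_mod] by (intro card_image) (auto simp: adm_def)
    have cardC: "card ?C = nat n - card (mod_sumset n X S)"
      using card_Diff_subset[OF fins sub] by simp
    have le: "card (mod_sumset n X S) \<le> nat n"
      using card_mono[OF _ sub] by simp
    have cardY: "card ?Y = card ?C"
      using inj_on_subset[OF inj_on_uminus_mod] by (intro card_image) auto
    \<comment> \<open>A common element \<open>-c + s = -x\<close> would give
      \<open>c = x + s\<close>, but \<open>c\<close> lies outside \<open>X + S\<close>.\<close>
    have disj: "mod_sumset n ?Y S \<subseteq> {0..<n} - (\<lambda>x. (- x) mod n) ` X"
    proof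
      fix z assume z: "z \<in> mod_sumset n ?Y S"
      then obtain c s where c: "c \<in> ?C" "s \<in> S" "z = ((- c) mod n + s) mod n"
        by (auto elim!: mod_sumsetE)
      have "z \<notin> (\<lambda>x. (- x) mod n) ` X"
      proof
        assume "z \<in> (\<lambda>x. (- x) mod n) ` X"
        then obtain x where x: "x \<in> X" "z = (- x) mod n" by auto
        then have "(- x) mod n = (s - c) mod n"
          using c by (simp add: mod_simps)
        then have "c mod n = (x + s) mod n"
          by (simp add: mod_eq_dvd_iff) (metis add.commute add_diff_eq diff_minus_eq_add dvd_minus_iff minus_diff_eq)
        then have "c = (x + s) mod n" using c by simp
        then have "c \<in> mod_sumset n X S" using x c by (intro mod_sumsetI)
        then show False using c by simp
      qed
      then show "z \<in> {0..<n} - (\<lambda>x. (- x) mod n) ` X" using sub z by blast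
    qed
    have negX: "(\<lambda>x. (- x) mod n) ` X \<subseteq> {0..<n}" using n by auto
    have "card (mod_sumset n ?Y S) \<le> card ({0..<n} - (\<lambda>x. (- x) mod n) ` X)"
      by (rule card_mono) (use disj in auto)
    also have "\<dots> = nat n - card X"
      using card_Diff_subset[OF _ negX] fina[OF aX(1)] cardX by simp
    finally have cY: "card (mod_sumset n ?Y S) \<le> nat n - card X" .
    have "X \<noteq> {}" using aX by (simp add: adm_def)
    then have "(\<lambda>x. (- x) mod n) ` X \<noteq> {}" by simp
    then have "mod_sumset n ?Y S \<noteq> {0..<n}" using disj negX by blast
    moreover have "?C \<noteq> {}" using aX sub unfolding adm_def by blast
    moreover have "?Y \<subseteq> {0..<n}" using n by auto
    ultimately have aY: "adm ?Y" unfolding adm_def by blast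
    have "card X \<le> nat n" using aX card_mono[of "{0..<n}" X] by (simp add: adm_def)
    then have "f ?Y \<le> f X" unfolding f_def using cY cardY cardC le by linarith
    then have "f ?Y = \<kappa>" using \<kappa>_le[OF aY] aX by simp
    then have "card X \<le> card ?Y" using that aY by (auto simp: atom_def)
    then show ?thesis using cardY cardC le by linarith
  qed

  \<comment> \<open>Submodularity:
    \<open>f (X \<inter> Y) + f (X \<union> Y) \<le> 2\<kappa>\<close>. The intersection is smaller
    than an atom, so its value exceeds \<kappa>, and that of the union falls below \<kappa>.\<close>
  have atom_disj: "X = Y" if "atom X" "atom Y" "X \<inter> Y \<noteq> {}" for X Y
  proof (rule ccontr)
    assume "X \<noteq> Y"
    have aX: "adm X" "f X = \<kappa>" and aY: "adm Y" "f Y = \<kappa>" using that by (auto simp: atom_def)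
    have cXY: "card X = card Y" using that by (auto simp: atom_def intro: antisym)
    have I: "mod_sumset n (X \<inter> Y) S \<subseteq> mod_sumset n X S \<inter> mod_sumset n Y S"
      by (auto simp: mod_sumset_def)
    have U: "mod_sumset n (X \<union> Y) S = mod_sumset n X S \<union> mod_sumset n Y S"
      by (force simp: mod_sumset_def)
    have 1: "card (mod_sumset n (X \<inter> Y) S) + card (mod_sumset n (X \<union> Y) S)
        \<le> card (mod_sumset n X S) + card (mod_sumset n Y S)"
      using card_mono[OF _ I] card_Un_Int[OF fins fins, of X Y] fins unfolding U by simp
    have 2: "card X + card Y = card (X \<union> Y) + card (X \<inter> Y)"
      using card_Un_Int fina aX aY by blast
    have aI: "adm (X \<inter> Y)"
    proof -
      have "mod_sumset n (X \<inter> Y) S \<subseteq> mod_sumset n X S" using I by blast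
      then have "mod_sumset n (X \<inter> Y) S \<noteq> {0..<n}" using aX(1) sub[of X] unfolding adm_def by blast
      then show ?thesis using aX that(3) unfolding adm_def by blast
    qed
    have "card (X \<inter> Y) < card X"
      using \<open>X \<noteq> Y\<close> cXY psubset_card_mono[OF fina[OF aX(1)], of "X \<inter> Y"]
        card_subset_eq[OF fina[OF aY(1)], of X] by blast
    then have fI: "f (X \<inter> Y) > \<kappa>"
      using that(1) aI \<kappa>_le[OF aI] unfolding atom_def by fastforce
    show False
    proof (cases "mod_sumset n (X \<union> Y) S = {0..<n}")
      case False
      then have "adm (X \<union> Y)" using aX aY unfolding adm_def by blast
      then have "\<kappa> \<le> f (X \<union> Y)" by (rule \<kappa>_le)
      then show False using fI 1 2 aX(2) aY(2) unfolding f_def by linarith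
    next
      \<comment> \<open>The union is not admissible, and \<open>dual\<close> replaces minimality:
        \<open>n \<ge> |X| + |X + S|\<close> forces
        \<open>|(X \<inter> Y) + S| \<le> \<kappa>\<close>, hence
        \<open>f (X \<inter> Y) < \<kappa>\<close>.\<close>
      case True
      then have "card (mod_sumset n (X \<union> Y) S) = nat n" by simp
      moreover have "card (X \<inter> Y) > 0"
        using that(3) fina[OF aX(1)] by (simp add: card_gt_0_iff)
      ultimately show False
        using fI 1 dual[OF that(1)] aX(2) aY(2) cXY unfolding f_def by linarith
    qed
  qed

  have atom_tr: "atom (tr t X)" if "atom X" for t X
  proof -
    have aX: "adm X" "f X = \<kappa>" using that by (auto simp: atom_def)
    have inj: "inj_on (\<lambda>x. (x + t) mod n) Y" if "Y \<subseteq> {0..<n}" for Y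
      using inj_on_subset[OF inj_on_translate_mod that] .
    have c1: "card (tr t X) = card X"
      unfolding tr_def using aX by (intro card_image inj) (auto simp: adm_def)
    have c2: "card (mod_sumset n (tr t X) S) = card (mod_sumset n X S)"
      unfolding tr_def mod_sumset_translate[OF n] by (intro card_image inj sub)
    have "card (mod_sumset n X S) < nat n"
      using aX(1) psubset_card_mono[of "{0..<n}" "mod_sumset n X S"] sub
      unfolding adm_def by auto
    then have "mod_sumset n (tr t X) S \<noteq> {0..<n}" using c2 by auto
    then have "adm (tr t X)" using aX n unfolding adm_def tr_def by auto
    then show ?thesis using that c1 c2 unfolding atom_def f_def by simp
  qed

  obtain x0 where x0: "x0 \<in> X0" using \<open>atom X0\<close> unfolding atom_def adm_def by blast
  define H where "H = tr (- x0) X0"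
  have aH: "atom H" unfolding H_def by (rule atom_tr[OF \<open>atom X0\<close>])
  have H0: "0 \<in> H" unfolding H_def tr_def using x0 by force
  show thesis
  proof
    show "H \<subseteq> {0..<n}" "mod_sumset n H S \<noteq> {0..<n}" using aH by (auto simp: atom_def adm_def)
    show "0 \<in> H" by (rule H0)
    show "(x - y) mod n \<in> H" if "x \<in> H" "y \<in> H" for x y
    proof -
      \<comment> \<open>The translate of \<open>H\<close> by \<open>-y\<close> is an atom that meets
        \<open>H\<close> in 0, so it is \<open>H\<close>.\<close>
      have "0 \<in> tr (- y) H" unfolding tr_def using that by force
      then have "tr (- y) H = H" using atom_disj[OF atom_tr[OF aH] aH] H0 by blast
      then show ?thesis using that unfolding tr_def by force
    qed
    show "card T + card (mod_sumset n H S) \<le> card (mod_sumset n T S) + card H"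
      if "T \<subseteq> {0..<n}" "T \<noteq> {}" "mod_sumset n T S \<noteq> {0..<n}" for T
    proof -
      have "adm T" using that by (simp add: adm_def)
      then have "f H \<le> f T" using \<kappa>_le aH by (simp add: atom_def)
      then show ?thesis unfolding f_def by linarith
    qed
  qed
qed

section \<open>From subgroups of the residues modulo n to divisors of n\<close>

lemma int_subgroup_eq_multiples:
  fixes K :: "int set"
  assumes "n > 0" "n \<in> K" and diff: "\<And>x y. x \<in> K \<Longrightarrow> y \<in> K \<Longrightarrow> x - y \<in> K"
  obtains g where "g > 0" "\<And>z. z \<in> K \<longleftrightarrow> g dvd z"
proof -
  have K0: "0 \<in> K" using diff[OF assms(2,2)] by simp
  have neg: "- x \<in> K" if "x \<in> K" for x using diff[OF K0 that] by simp
  have add: "x + y \<in> K" if "x \<in> K" "y \<in> K" for x y using diff[OF that(1) neg[OF that(2)]] by simp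
  have natm: "int j * x \<in> K" if "x \<in> K" for x j
    by (induction j) (use K0 add that in \<open>auto simp: algebra_simps\<close>)
  have mult: "j * x \<in> K" if "x \<in> K" for x j
    using natm[OF that, of "nat j"] neg[OF natm[OF that, of "nat (- j)"]] by (cases "j \<ge> 0") auto
  define P where "P m \<longleftrightarrow> m > 0 \<and> int m \<in> K" for m
  have "P (nat n)" using assms by (simp add: P_def)
  then have PL: "P (LEAST m. P m)" by (rule LeastI)
  define g where "g = int (LEAST m. P m)"
  have g: "g > 0" "g \<in> K" using PL by (auto simp: P_def g_def)
  have "g dvd z" if "z \<in> K" for z
  proof (rule ccontr)
    assume "\<not> g dvd z"
    then have pos: "z mod g > 0" using g(1) by (simp add: dvd_eq_mod_eq_0 order_le_neq_trans)
    have "z - (z div g) * g \<in> K" by (intro diff that mult g)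
    then have "z mod g \<in> K" by (simp add: minus_div_mult_eq_mod)
    then have "P (nat (z mod g))" using pos by (simp add: P_def)
    then have "(LEAST m. P m) \<le> nat (z mod g)" by (rule Least_le)
    then show False using g(1) pos pos_mod_bound[of g z] unfolding g_def by linarith
  qed
  moreover have "z \<in> K" if "g dvd z" for z
    using that mult[OF g(2)] by (metis dvdE mult.commute)
  ultimately show thesis using that g by blast
qed

lemma card_residue_preimage:
  fixes n g :: int
  assumes "g > 0" "n > 0" "g dvd n" "T \<subseteq> {0..<g}"
  shows "card {z \<in> {0..<n}. z mod g \<in> T} = nat (n div g) * card T"
proof -
  define q where "q = n div g"
  have n: "n = g * q" using assms q_def by simp
  have q0: "q > 0" using assms n by (simp add: zero_less_mult_iff)
  have "bij_betw (\<lambda>(t, j). t + g * j) (T \<times> {0..<q}) {z \<in> {0..<n}. z mod g \<in> T}"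
  proof (rule bij_betw_byWitness[where f' = "\<lambda>z. (z mod g, z div g)"])
    show "\<forall>a\<in>T \<times> {0..<q}. ((case a of (t, j) \<Rightarrow> t + g * j) mod g, (case a of (t, j) \<Rightarrow> t + g * j) div g) = a"
      using assms by auto
    show "\<forall>a'\<in>{z \<in> {0..<n}. z mod g \<in> T}. (case (a' mod g, a' div g) of (t, j) \<Rightarrow> t + g * j) = a'"
      by auto
    show "(\<lambda>(t, j). t + g * j) ` (T \<times> {0..<q}) \<subseteq> {z \<in> {0..<n}. z mod g \<in> T}"
    proof clarify
      fix t j assume tj: "t \<in> T" "j \<in> {0..<q}"
      then have t: "0 \<le> t" "t < g" using assms by auto
      have "g * j + g \<le> g * q" using tj assms(1) mult_left_mono[of "j + 1" q g] by (simp add: algebra_simps)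
      then show "t + g * j \<in> {0..<n} \<and> (t + g * j) mod g \<in> T"
        using t tj assms n by auto
    qed
    show "(\<lambda>z. (z mod g, z div g)) ` {z \<in> {0..<n}. z mod g \<in> T} \<subseteq> T \<times> {0..<q}"
    proof (rule image_subsetI)
      fix z assume z: "z \<in> {z \<in> {0..<n}. z mod g \<in> T}"
      have "g * (z div g) \<le> z" using assms(1) by (simp add: mult_div_mod_eq[symmetric] minus_mod_eq_mult_div[symmetric])
      then have "g * (z div g) < g * q" using z n by simp
      then show "(z mod g, z div g) \<in> T \<times> {0..<q}"
        using z assms(1) by (simp add: pos_imp_zdiv_nonneg_iff)
    qed
  qed
  then have "card {z \<in> {0..<n}. z mod g \<in> T} = card (T \<times> {0..<q})"
    by (simp add: bij_betw_same_card)
  then show ?thesis by (simp add: card_cartesian_product q_def)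
qed

text \<open>The subgroup \<open>H\<close> consists of the multiples of a divisor \<open>g\<close>.
  Lifting sets of classes modulo \<open>g\<close> to unions of cosets of \<open>H\<close> multiplies
  all cardinalities by \<open>n div g\<close>, so the inequality descends to \<open>g\<close>. The
  lower bound for \<open>card (residues_mod n S)\<close> says that \<open>S\<close> misses fewer
  than \<open>n div g\<close> residues of the classes modulo \<open>g\<close> which it
  meets.\<close>

lemma isoperimetric_modulus:
  fixes n :: int and S :: "int set"
  assumes n: "n > 0" and S0: "0 \<in> S" and S: "residues_mod n S \<noteq> {0..<n}"
  obtains g where "g > 0" "g dvd n" "card (residues_mod g S) < nat g"
    "nat (n div g) * (card (residues_mod g S) - 1) + 1 \<le> card (residues_mod n S)"
    "\<And>T. T \<subseteq> {0..<g} \<Longrightarrow> T \<noteq> {} \<Longrightarrow> mod_sumset g T S \<noteq> {0..<g} \<Longrightarrow>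
       card T + (card (residues_mod g S) - 1) \<le> card (mod_sumset g T S)"
proof -
  obtain H where H: "H \<subseteq> {0..<n}" "0 \<in> H"
    "\<And>x y. x \<in> H \<Longrightarrow> y \<in> H \<Longrightarrow> (x - y) mod n \<in> H"
    "mod_sumset n H S \<noteq> {0..<n}"
    "\<And>T. T \<subseteq> {0..<n} \<Longrightarrow> T \<noteq> {} \<Longrightarrow> mod_sumset n T S \<noteq> {0..<n} \<Longrightarrow>
       card T + card (mod_sumset n H S) \<le> card (mod_sumset n T S) + card H"
    using isoperimetric_subgroup[OF n S] by blast
  obtain g where g: "g > 0" "\<And>z. z \<in> {z. z mod n \<in> H} \<longleftrightarrow> g dvd z"
  proof (rule int_subgroup_eq_multiples[of n "{z. z mod n \<in> H}"])
    show "n \<in> {z. z mod n \<in> H}" using H by simp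
    show "x - y \<in> {z. z mod n \<in> H}" if "x \<in> {z. z mod n \<in> H}" "y \<in> {z. z mod n \<in> H}" for x y
      using H(3)[of "x mod n" "y mod n"] that by (simp add: mod_simps)
  qed (use n in auto)
  have gn: "g dvd n" using g(2)[of n] H by simp
  have H_eq: "H = {z \<in> {0..<n}. z mod g \<in> {0}}"
  proof -
    have "z \<in> H \<longleftrightarrow> z \<in> {0..<n} \<and> z mod g = 0" for z
      using g(2)[of z] H(1) by (auto simp: dvd_eq_mod_eq_0)
    then show ?thesis by (intro set_eqI) simp
  qed
  define q where "q = nat (n div g)"
  have q0: "q > 0" unfolding q_def using n g gn by (auto simp: pos_imp_zdiv_pos_iff zdvd_imp_le)
  have cH: "card H = q"
    unfolding H_eq using card_residue_preimage[OF g(1) n gn, of "{0}"] g by (simp add: q_def)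
  have lift: "mod_sumset n {z \<in> {0..<n}. z mod g \<in> T} S = {z \<in> {0..<n}. z mod g \<in> mod_sumset g T S}"
    if "T \<subseteq> {0..<g}" for T
  proof (intro equalityI subsetI)
    fix z assume "z \<in> mod_sumset n {z \<in> {0..<n}. z mod g \<in> T} S"
    then obtain x s where xs: "x mod g \<in> T" "s \<in> S" "z = (x + s) mod n"
      by (auto elim!: mod_sumsetE)
    then have "z mod g = (x mod g + s) mod g"
      using gn by (simp add: mod_mod_cancel mod_simps)
    then show "z \<in> {z \<in> {0..<n}. z mod g \<in> mod_sumset g T S}"
      using xs n by (auto intro: mod_sumsetI)
  next
    fix z assume z: "z \<in> {z \<in> {0..<n}. z mod g \<in> mod_sumset g T S}"
    then obtain t s where ts: "t \<in> T" "s \<in> S" "z mod g = (t + s) mod g"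
      by (auto elim!: mod_sumsetE)
    have "(z - s) mod n mod g = (z - s) mod g" using gn by (simp add: mod_mod_cancel)
    also have "\<dots> = t mod g" using ts(3) by (simp add: mod_eq_dvd_iff algebra_simps)
    also have "\<dots> = t" using ts that by auto
    finally have "(z - s) mod n \<in> {z \<in> {0..<n}. z mod g \<in> T}" using ts n by simp
    moreover have "z = ((z - s) mod n + s) mod n" using z by (simp add: mod_simps)
    ultimately show "z \<in> mod_sumset n {z \<in> {0..<n}. z mod g \<in> T} S"
      using ts by (intro mod_sumsetI)
  qed
  have HS: "mod_sumset n H S = {z \<in> {0..<n}. z mod g \<in> residues_mod g S}"
    unfolding H_eq using lift[of "{0}"] g by (simp add: mod_sumset_zero)
  define u where "u = card (residues_mod g S)"
  have u0: "u > 0" unfolding u_def using S0 finite_residues_mod[OF g(1)] by (auto simp: card_gt_0_iff)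
  have cHS: "card (mod_sumset n H S) = q * u"
    unfolding HS u_def q_def by (rule card_residue_preimage[OF g(1) n gn residues_mod_subset[OF g(1)]])
  have qu: "q * u = q * (u - 1) + q" using u0 by (cases u) auto
  show thesis
  proof
    show "g > 0" "g dvd n" by fact+
    have "residues_mod g S \<noteq> {0..<g}"
    proof
      assume "residues_mod g S = {0..<g}"
      then have "mod_sumset n H S = {0..<n}" unfolding HS using g by auto
      then show False using H by simp
    qed
    then show "card (residues_mod g S) < nat g"
      using psubset_card_mono[of "{0..<g}" "residues_mod g S"] residues_mod_subset[OF g(1), of S] by auto
    \<comment> \<open>The isoperimetric inequality for \<open>T = {0}\<close>, admissible by the
      assumption on \<open>S\<close>.\<close>
    have "1 + q * u \<le> card (residues_mod n S) + q"
      using H(5)[of "{0}"] S n cH cHS by (simp add: mod_sumset_zero)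
    then show "nat (n div g) * (card (residues_mod g S) - 1) + 1 \<le> card (residues_mod n S)"
      using qu unfolding u_def q_def by simp
    show "card T + (card (residues_mod g S) - 1) \<le> card (mod_sumset g T S)"
      if T: "T \<subseteq> {0..<g}" "T \<noteq> {}" "mod_sumset g T S \<noteq> {0..<g}" for T
    proof -
      let ?T = "{z \<in> {0..<n}. z mod g \<in> T}"
      have gle: "g \<le> n" using gn n by (simp add: zdvd_imp_le)
      obtain t where t: "t \<in> T" using T by blast
      then have "t \<in> ?T" using T gle by auto
      then have ne: "?T \<noteq> {}" by blast
      have sg: "mod_sumset g T S \<subseteq> {0..<g}" by (rule mod_sumset_subset[OF g(1)])
      obtain y where y: "y \<in> {0..<g}" "y \<notin> mod_sumset g T S" using T sg by blast
      then have "y \<in> {0..<n}" "y \<notin> mod_sumset n ?T S" using lift[OF T(1)] gle by auto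
      then have "mod_sumset n ?T S \<noteq> {0..<n}" by blast
      moreover have "?T \<subseteq> {0..<n}" by blast
      ultimately have "card ?T + q * u \<le> card (mod_sumset n ?T S) + q"
        using H(5)[OF _ ne] cH cHS by simp
      moreover have "card ?T = q * card T"
        using card_residue_preimage[OF g(1) n gn T(1)] by (simp add: q_def)
      moreover have "card (mod_sumset n ?T S) = q * card (mod_sumset g T S)"
        unfolding lift[OF T(1)] using card_residue_preimage[OF g(1) n gn sg] by (simp add: q_def)
      ultimately have "q * (card T + (u - 1)) \<le> q * card (mod_sumset g T S)"
        using qu unfolding add_mult_distrib2 by linarith
      then show ?thesis using q0 unfolding u_def by simp
    qed
  qed
qed

section \<open>Lev's theorem\<close>

lemma sumset_foldI: "set_mset B \<subseteq> X \<Longrightarrow> size B = h \<Longrightarrow> \<Sum>\<^sub># B \<in> sumset_fold h X"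
  unfolding sumset_fold_def by blast

lemma sumset_foldE:
  assumes "z \<in> sumset_fold h X"
  obtains B where "set_mset B \<subseteq> X" "size B = h" "z = \<Sum>\<^sub># B"
  using assms unfolding sumset_fold_def by blast

lemma sumset_fold_0: "sumset_fold 0 X = {0}"
  unfolding sumset_fold_def by auto

lemma sumset_fold_Suc: "sumset_fold (Suc h) X = (\<lambda>(x, y). x + y) ` (X \<times> sumset_fold h X)"
proof (intro equalityI subsetI)
  fix z assume "z \<in> sumset_fold (Suc h) X"
  then obtain B where B: "set_mset B \<subseteq> X" "size B = Suc h" "z = \<Sum>\<^sub># B"
    by (rule sumset_foldE)
  then obtain b B' where "B = add_mset b B'" by (metis size_eq_Suc_imp_eq_union)
  then show "z \<in> (\<lambda>(x, y). x + y) ` (X \<times> sumset_fold h X)"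
    using B by (auto intro!: image_eqI[of _ _ "(b, \<Sum>\<^sub># B')"] sumset_foldI)
next
  fix z assume "z \<in> (\<lambda>(x, y). x + y) ` (X \<times> sumset_fold h X)"
  then obtain x B where "x \<in> X" "set_mset B \<subseteq> X" "size B = h" "z = x + \<Sum>\<^sub># B"
    by (auto elim: sumset_foldE)
  then show "z \<in> sumset_fold (Suc h) X"
    using sumset_foldI[of "add_mset x B" X "Suc h"] by simp
qed

lemma sumset_fold_1: "sumset_fold 1 X = X"
  by (force simp: sumset_fold_Suc sumset_fold_0)

lemma finite_sumset_fold: "finite X \<Longrightarrow> finite (sumset_fold h X)"
  by (induction h) (auto simp: sumset_fold_0 sumset_fold_Suc)

lemma sumset_fold_Suc_mono: "0 \<in> X \<Longrightarrow> sumset_fold h X \<subseteq> sumset_fold (Suc h) X"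
  unfolding sumset_fold_Suc by force

lemma residues_mod_sumset_fold_Suc:
  "residues_mod g (sumset_fold (Suc h) X) = mod_sumset g (residues_mod g (sumset_fold h X)) X"
proof -
  have "(x + y) mod g = (y mod g + x) mod g" for x y :: int
    by (simp add: mod_simps add.commute)
  then show ?thesis
    unfolding sumset_fold_Suc mod_sumset_def by (force simp: image_iff)
qed

text \<open>The translates \<open>X + Min Y\<close> and \<open>Max X + Y\<close> share at most the
  point \<open>Max X + Min Y\<close>.\<close>

lemma card_int_sumset_ge:
  fixes X Y :: "int set"
  assumes "finite X" "finite Y" "X \<noteq> {}" "Y \<noteq> {}"
  shows "card X + card Y \<le> card ((\<lambda>(x, y). x + y) ` (X \<times> Y)) + 1"
proof -
  let ?P = "(\<lambda>x. x + Min Y) ` X" and ?Q = "(\<lambda>y. Max X + y) ` Y"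
  have "?P \<inter> ?Q \<subseteq> {Max X + Min Y}"
  proof
    fix z assume "z \<in> ?P \<inter> ?Q"
    then obtain x y where "x \<in> X" "y \<in> Y" "z = x + Min Y" "z = Max X + y" by auto
    moreover from this have "x \<le> Max X" "Min Y \<le> y" using assms by simp_all
    ultimately show "z \<in> {Max X + Min Y}" by simp
  qed
  then have I: "card (?P \<inter> ?Q) \<le> 1" using card_mono[of "{Max X + Min Y}"] by force
  have "Max X \<in> X" "Min Y \<in> Y" using assms by simp_all
  then have sub: "?P \<union> ?Q \<subseteq> (\<lambda>(x, y). x + y) ` (X \<times> Y)" by force
  have "card ?P = card X" "card ?Q = card Y" by (auto intro!: card_image inj_onI)
  then have "card X + card Y = card (?P \<union> ?Q) + card (?P \<inter> ?Q)"
    using card_Un_Int[of ?P ?Q] assms by simp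
  also have "card (?P \<union> ?Q) \<le> card ((\<lambda>(x, y). x + y) ` (X \<times> Y))"
    using assms by (intro card_mono sub) auto
  finally show ?thesis using I by linarith
qed

text \<open>For one term \<open>b\<close> of \<open>B\<close> after another, all elements of
  \<open>A\<close> congruent to \<open>b\<close> are added. The sums stay in a single class modulo
  \<open>g\<close>, and the integer bound gains at least \<open>w\<close> elements each
  time.\<close>

lemma sumset_fold_class_large:
  fixes A :: "int set"
  assumes "finite A" "set_mset B \<subseteq> A"
    and "\<And>b. b \<in># B \<Longrightarrow> w + 1 \<le> card {z \<in> A. z mod g = b mod g}"
  shows "1 + size B * w \<le> card {z \<in> sumset_fold (size B) A. z mod g = \<Sum>\<^sub># B mod g}"
  using assms(2,3)
proof (induction B)
  case empty
  have "{z \<in> sumset_fold 0 A. z mod g = 0 mod g} = {0}" by (auto simp: sumset_fold_0)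
  then show ?case by simp
next
  case (add b B)
  let ?Z = "{z \<in> sumset_fold (size B) A. z mod g = \<Sum>\<^sub># B mod g}"
  let ?C = "{z \<in> A. z mod g = b mod g}"
  have IH: "1 + size B * w \<le> card ?Z" using add by simp
  have w: "w + 1 \<le> card ?C" using add.prems by simp
  have fin: "finite ?Z" "finite ?C" using assms(1) by (simp_all add: finite_sumset_fold)
  have ne: "?Z \<noteq> {}" "?C \<noteq> {}" using IH w by (auto simp del: Collect_empty_eq)
  have "(\<lambda>(x, y). x + y) ` (?C \<times> ?Z) \<subseteq>
      {z \<in> sumset_fold (size (add_mset b B)) A. z mod g = \<Sum>\<^sub># (add_mset b B) mod g}"
    by (auto simp: sumset_fold_Suc intro!: mod_add_cong)
  then have "card ((\<lambda>(x, y). x + y) ` (?C \<times> ?Z)) \<le>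
      card {z \<in> sumset_fold (size (add_mset b B)) A. z mod g = \<Sum>\<^sub># (add_mset b B) mod g}"
    using assms(1) by (intro card_mono) (simp_all add: finite_sumset_fold)
  then show ?case using card_int_sumset_ge[OF fin(2,1) ne(2,1)] IH w by simp
qed

lemma sum_mset_mod_const:
  fixes B :: "int multiset"
  assumes "\<And>b. b \<in># B \<Longrightarrow> b mod g = c mod g"
  shows "\<Sum>\<^sub># B mod g = (int (size B) * c) mod g"
  using assms
proof (induction B)
  case (add b B)
  then have "(b + \<Sum>\<^sub># B) mod g = (c + int (size B) * c) mod g"
    by (intro mod_add_cong) auto
  then show ?case by (simp add: algebra_simps)
qed simp

text \<open>The new elements \<open>D = (h+1)A - hA\<close> are counted by classes modulo
  \<open>g\<close>. With \<open>|A| = M + 1\<close> and \<open>e = q(u - 1)\<close>, unless they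
  number at least \<open>n\<close>, one class supplies \<open>1 + (h+1)(M - 1 - e)\<close> of them
  and \<open>(h+1)(u - 1)\<close> further classes supply \<open>q\<close> each, in total
  \<open>(h+1)(M - 1) + 1\<close>. What a bad class may lack is made up in a new class.\<close>

theorem card_sumset_fold_Suc_ge:
  fixes A :: "int set" and n :: int
  assumes finA: "finite A" and A0: "0 \<in> A" and An: "n \<in> A" and n: "n > 0"
    and Asub: "A \<subseteq> {0..n}" and gcd: "Gcd A = 1" and h: "h \<ge> 1"
  shows "card (sumset_fold h A) + min (nat n) (Suc h * (card A - 2) + 1) \<le> card (sumset_fold (Suc h) A)"
proof -
  let ?F = "sumset_fold (Suc h) A" and ?F' = "sumset_fold h A"
  define D where "D = ?F - ?F'"
  have finF: "finite ?F" "finite ?F'" by (simp_all add: finA finite_sumset_fold)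
  have finD: "finite D" unfolding D_def using finF by simp
  have FF: "?F' \<subseteq> ?F" by (rule sumset_fold_Suc_mono[OF A0])
  have cardF: "card ?F = card ?F' + card D"
    unfolding D_def using card_Diff_subset[OF finF(2) FF] card_mono[OF finF(1) FF] by simp
  have AF: "A \<subseteq> ?F"
  proof
    fix x assume "x \<in> A"
    moreover have "0 \<in> sumset_fold h A"
      using sumset_foldI[of "replicate_mset h 0" A h] A0 by (simp add: sum_mset_replicate_mset)
    ultimately show "x \<in> ?F" unfolding sumset_fold_Suc by force
  qed
  \<comment> \<open>Only 0 and \<open>n\<close> coincide modulo \<open>n\<close>, whence
    \<open>|A| = M + 1\<close>.\<close>
  define M where "M = card (residues_mod n A)"
  have M: "card A = M + 1"
  proof -
    have "residues_mod n A = A - {n}"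
    proof (intro equalityI subsetI)
      fix z assume "z \<in> residues_mod n A"
      then obtain x where x: "x \<in> A" "z = x mod n" by auto
      show "z \<in> A - {n}"
      proof (cases "x = n")
        case True then show ?thesis using x A0 n by simp
      next
        case False
        then have "0 \<le> x" "x < n" using x Asub by (auto simp: order_less_le)
        then have "x mod n = x" by simp
        then show ?thesis using x False by simp
      qed
    next
      fix z assume z: "z \<in> A - {n}"
      then have "0 \<le> z" "z < n" using Asub by (auto simp: order_less_le)
      then have "z = z mod n" by simp
      then show "z \<in> residues_mod n A" using z by blast
    qed
    then show ?thesis unfolding M_def using An finA card_Suc_Diff1[of A n] by simp
  qed

  text \<open>The largest element of \<open>(h+1)A\<close> in a residue class modulo \<open>n\<close> is not in \<open>hA\<close>,
    since otherwise adding \<open>n \<in> A\<close> would give a larger one.\<close>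
  have residues_le: "card (residues_mod n {z \<in> ?F. z mod g = x}) \<le> card {z \<in> D. z mod g = x}"
    if "g dvd n" for g x
  proof -
    have "residues_mod n {z \<in> ?F. z mod g = x} \<subseteq> residues_mod n {z \<in> D. z mod g = x}"
    proof
      fix t assume "t \<in> residues_mod n {z \<in> ?F. z mod g = x}"
      then obtain z where z: "z \<in> ?F" "z mod g = x" "t = z mod n" by auto
      let ?R = "{y \<in> ?F. y mod n = t}"
      have R: "finite ?R" "z \<in> ?R" using finF z by auto
      define m where "m = Max ?R"
      have m: "m \<in> ?R" unfolding m_def using R by (intro Max_in) auto
      have "m \<notin> ?F'"
      proof
        assume "m \<in> ?F'"
        then have "n + m \<in> ?F" unfolding sumset_fold_Suc using An by force
        then have "n + m \<in> ?R" using m by simp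
        then have "n + m \<le> m" unfolding m_def using R by (intro Max_ge)
        then show False using n by simp
      qed
      moreover have "m mod g = z mod g"
      proof -
        have "m mod n mod g = z mod n mod g" using m z by simp
        then show ?thesis using that by (simp add: mod_mod_cancel)
      qed
      ultimately show "t \<in> residues_mod n {z \<in> D. z mod g = x}"
        using m z unfolding D_def by (intro image_eqI[of _ _ m]) auto
    qed
    then have "card (residues_mod n {z \<in> ?F. z mod g = x}) \<le> card (residues_mod n {z \<in> D. z mod g = x})"
      using finD by (intro card_mono) auto
    also have "\<dots> \<le> card {z \<in> D. z mod g = x}" using finD by (intro card_image_le) simp
    finally show ?thesis .
  qed

  have "min (nat n) (Suc h * (M - 1) + 1) \<le> card D"
  proof (cases "residues_mod n A = {0..<n}")
    case True
    \<comment> \<open>Modulus 1 puts all integers into one class, so \<open>residues_le\<close>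
      bounds the whole of \<open>D\<close>.\<close>
    have "residues_mod n A \<subseteq> residues_mod n {z \<in> ?F. z mod 1 = 0}" using AF by auto
    then have "card (residues_mod n A) \<le> card (residues_mod n {z \<in> ?F. z mod 1 = 0})"
      by (intro card_mono finite_residues_mod[OF n])
    also have "\<dots> \<le> card {z \<in> D. z mod 1 = 0}" by (rule residues_le) simp
    finally show ?thesis using True by simp
  next
    case False
    obtain g where g: "g > 0" and gn: "g dvd n" and ug: "card (residues_mod g A) < nat g"
      and Mge: "nat (n div g) * (card (residues_mod g A) - 1) + 1 \<le> M"
      and iso: "\<And>T. T \<subseteq> {0..<g} \<Longrightarrow> T \<noteq> {} \<Longrightarrow> mod_sumset g T A \<noteq> {0..<g} \<Longrightarrow>
       card T + (card (residues_mod g A) - 1) \<le> card (mod_sumset g T A)"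
      using isoperimetric_modulus[OF n A0 False] unfolding M_def by metis

    \<comment> \<open>Sizes of the classes of A modulo g\<close>
    define U where "U = residues_mod g A"
    define u where "u = card U"
    define q where "q = nat (n div g)"
    \<comment> \<open>The number of residues modulo \<open>n\<close> in \<open>u - 1\<close> full
      classes modulo \<open>g\<close>.\<close>
    define e where "e = q * (u - 1)"
    have finU: "finite U" unfolding U_def by (rule finite_residues_mod[OF g])
    have Me: "e + 1 \<le> M" using Mge unfolding e_def q_def u_def U_def .
    have nq: "nat n = nat g * q"
      unfolding q_def using gn g n by (simp flip: nat_mult_distrib add: pos_imp_zdiv_nonneg_iff)
    have U0: "0 \<in> U" unfolding U_def using A0 by force
    \<comment> \<open>If 0 were the only class, \<open>g\<close> would divide
      \<open>Gcd A = 1\<close>, against \<open>u < g\<close>.\<close>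
    have u2: "u \<ge> 2"
    proof (rule ccontr)
      assume "\<not> u \<ge> 2"
      moreover have u0: "u > 0" unfolding u_def using U0 finU by (auto simp: card_gt_0_iff)
      ultimately have "u = 1" by simp
      then have "U = {0}" unfolding u_def using U0 by (metis card_1_singletonE singletonD)
      then have "\<forall>x\<in>A. g dvd x" unfolding U_def by (auto simp: dvd_eq_mod_eq_0)
      then have "g dvd Gcd A" by (intro Gcd_greatest) simp
      then have "g = 1" using gcd g by simp
      then show False using ug u0 unfolding u_def U_def by simp
    qed
    define cls where "cls c = {z \<in> A. z mod g = c}" for c
    \<comment> \<open>Residues are counted instead of elements, since 0 and \<open>n\<close> agree
      modulo \<open>n\<close>.\<close>
    define w where "w c = card (residues_mod n (cls c))" for c
    have card_class: "card {z \<in> {0..<n}. z mod g = c} = q" if "c \<in> {0..<g}" for c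
      using card_residue_preimage[OF g n gn, of "{c}"] that by (simp add: q_def)
    have fin_class: "finite {z \<in> {0..<n}. z mod g = c}" for c
      by (rule finite_subset[of _ "{0..<n}"]) auto
    have U_sub: "U \<subseteq> {0..<g}" unfolding U_def by (rule residues_mod_subset[OF g])
    have cls_sub: "residues_mod n (cls c) \<subseteq> {z \<in> {0..<n}. z mod g = c}" for c
      unfolding cls_def using n gn by (auto simp: mod_mod_cancel)
    have wq: "w c \<le> q" if "c \<in> U" for c
    proof -
      have "w c \<le> card {z \<in> {0..<n}. z mod g = c}"
        unfolding w_def by (rule card_mono[OF fin_class cls_sub])
      then show ?thesis using card_class U_sub that by auto
    qed
    have w_card: "w c \<le> card (cls c)" for c
      unfolding w_def by (rule card_image_le) (simp add: cls_def finA)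
    have w_sum: "(\<Sum>c\<in>U. w c) = M"
    proof -
      have "residues_mod n A = (\<Union>c\<in>U. residues_mod n (cls c))"
        unfolding U_def cls_def by auto
      then have "M = card (\<Union>c\<in>U. residues_mod n (cls c))" unfolding M_def by simp
      also have "\<dots> = (\<Sum>c\<in>U. card (residues_mod n (cls c)))"
      proof (rule card_UN_disjoint)
        show "\<forall>i\<in>U. \<forall>j\<in>U. i \<noteq> j \<longrightarrow> residues_mod n (cls i) \<inter> residues_mod n (cls j) = {}"
          using cls_sub by blast
      qed (use finU finite_residues_mod[OF n] in auto)
      finally show ?thesis unfolding w_def by simp
    qed
    \<comment> \<open>The other \<open>u - 1\<close> classes hold at most \<open>q\<close> residues
      each.\<close>
    have W1: "M \<le> w c + e" if "c \<in> U" for c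
    proof -
      have "M = w c + (\<Sum>c\<in>U - {c}. w c)"
        using w_sum sum.remove[OF finU that, of w] by simp
      also have "(\<Sum>c\<in>U - {c}. w c) \<le> of_nat (card (U - {c})) * q"
        by (rule sum_bounded_above) (use wq in auto)
      also have "of_nat (card (U - {c})) * q = e"
        unfolding e_def u_def using that finU by simp
      finally show ?thesis by simp
    qed
    \<comment> \<open>Here \<open>u - 2\<close> other classes remain. As \<open>M > e\<close>, two
      different classes together hold more than \<open>q\<close> residues.\<close>
    have W2: "M + q \<le> w c + w d + e" if "c \<in> U" "d \<in> U" "c \<noteq> d" for c d
    proof -
      have "M = w c + (w d + (\<Sum>c\<in>U - {c} - {d}. w c))"
        using w_sum sum.remove[OF finU that(1), of w] sum.remove[of "U - {c}" d w] finU that by simp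
      also have "(\<Sum>c\<in>U - {c} - {d}. w c) \<le> of_nat (card (U - {c} - {d})) * q"
        by (rule sum_bounded_above) (use wq in auto)
      also have "card (U - {c} - {d}) = u - 2"
        unfolding u_def using that finU by (simp add: card_Diff_singleton_if)
      finally have "M \<le> w c + w d + (u - 2) * q" by simp
      moreover have "e = (u - 2) * q + q"
        unfolding e_def using u2 by (cases u; cases "u - 1") (auto simp: algebra_simps)
      ultimately show ?thesis by simp
    qed

    \<comment> \<open>Classes modulo g met by jA\<close>
    define V where "V j = residues_mod g (sumset_fold j A)" for j
    have V_sub: "V j \<subseteq> {0..<g}" for j unfolding V_def by (rule residues_mod_subset[OF g])
    have finV: "finite (V j)" for j unfolding V_def by (rule finite_residues_mod[OF g])
    have V_Suc: "V (Suc j) = mod_sumset g (V j) A" for j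
      unfolding V_def by (rule residues_mod_sumset_fold_Suc)
    have V_mono: "V j \<subseteq> V (Suc j)" for j
      unfolding V_def by (intro image_mono sumset_fold_Suc_mono A0)
    have V_ne: "V j \<noteq> {}" for j
      by (induction j) (use V_mono in \<open>auto simp: V_def sumset_fold_0\<close>)
    have iso': "card T + (u - 1) \<le> card (mod_sumset g T A)"
      if "T \<subseteq> {0..<g}" "T \<noteq> {}" "mod_sumset g T A \<noteq> {0..<g}" for T
      using iso[OF that] unfolding u_def U_def .
    have V_card: "V j = {0..<g} \<or> j * (u - 1) + 1 \<le> card (V j)" for j
    proof (induction j)
      case 0
      then show ?case by (simp add: V_def sumset_fold_0)
    next
      case (Suc j)
      show ?case
      proof (cases "V (Suc j) = {0..<g}")
        case False
        then have "V j \<noteq> {0..<g}" using V_mono[of j] V_sub[of "Suc j"] by blast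
        then have "j * (u - 1) + 1 \<le> card (V j)" using Suc by simp
        moreover have "card (V j) + (u - 1) \<le> card (V (Suc j))"
          using iso'[OF V_sub V_ne] False unfolding V_Suc by simp
        ultimately show ?thesis by simp
      qed simp
    qed
    have V_le: "card (V j) \<le> nat g" for j
      using card_mono[OF _ V_sub, of j] by simp

    \<comment> \<open>Classes modulo g that (h+1)A meets but does not fill\<close>
    define bad where "bad x \<longleftrightarrow> x \<in> V (Suc h) \<and> card (residues_mod n {z \<in> ?F. z mod g = x}) < q" for x
    \<comment> \<open>Let \<open>t\<close> be a residue in class \<open>x\<close> and
      \<open>s\<close> the sum of \<open>B\<close>. The residues of \<open>A\<close> in the class of
      \<open>b\<close>, and those of \<open>t - s - y\<close> with \<open>y \<in> A\<close> in the
      class of \<open>b'\<close>, lie in one class of \<open>q\<close> residues. If together they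
      number more than \<open>q\<close>, they meet and \<open>t\<close> is attained; so
      \<open>x\<close> would be filled.\<close>
    have pigeonhole: "w (b mod g) + w (b' mod g) \<le> q"
      if bx: "bad x" and B: "set_mset (add_mset b (add_mset b' B)) \<subseteq> A" "Suc (Suc (size B)) = Suc h"
        "(b + (b' + \<Sum>\<^sub># B)) mod g = x" for x b b' B
    proof (rule ccontr)
      assume gt: "\<not> ?thesis"
      have "{z \<in> {0..<n}. z mod g = x} \<subseteq> residues_mod n {z \<in> ?F. z mod g = x}"
      proof
        fix t assume t: "t \<in> {z \<in> {0..<n}. z mod g = x}"
        define s where "s = \<Sum>\<^sub># B"
        let ?K = "{z \<in> {0..<n}. z mod g = b mod g}"
        let ?P = "residues_mod n (cls (b mod g))"
        let ?Q = "(\<lambda>y. (t - s - y) mod n) ` cls (b' mod g)"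
        have P: "?P \<subseteq> ?K" by (rule cls_sub)
        have Q: "?Q \<subseteq> ?K"
        proof
          fix z assume "z \<in> ?Q"
          then obtain y where y: "y mod g = b' mod g" "z = (t - s - y) mod n" by (auto simp: cls_def)
          have "z mod g = (t - s - y) mod g" using y gn by (simp add: mod_mod_cancel)
          also have "\<dots> = ((b + (b' + s)) - s - b') mod g"
            using t B(3) y(1) unfolding s_def by (intro mod_diff_cong) auto
          finally show "z \<in> ?K" using n y by simp
        qed
        \<comment> \<open>Counted through residues, because
          \<open>y \<mapsto> (t - s - y) mod n\<close> need not be injective on integers: 0 and
          \<open>n\<close> have the same image.\<close>
        have Q_eq: "?Q = (\<lambda>r. ((- r) mod n + (t - s)) mod n) ` residues_mod n (cls (b' mod g))"
          unfolding image_image by (rule image_cong) (auto simp: mod_simps)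
        have inj: "inj_on (\<lambda>r. ((- r) mod n + (t - s)) mod n) {0..<n}"
          using comp_inj_on[OF inj_on_uminus_mod inj_on_subset[OF inj_on_translate_mod]] n
          by (auto simp: o_def image_subset_iff)
        have cQ: "card ?Q = w (b' mod g)"
          unfolding w_def Q_eq
          by (intro card_image inj_on_subset[OF inj] residues_mod_subset[OF n])
        have "b mod g \<in> {0..<g}" using g by simp
        then have "card (?P \<union> ?Q) \<le> q"
          using card_mono[OF fin_class Un_least[OF P Q]] card_class by simp
        moreover have "finite ?P" "finite ?Q" using finite_subset[OF P fin_class] finite_subset[OF Q fin_class] .
        ultimately have "card (?P \<inter> ?Q) > 0"
          using card_Un_Int[of ?P ?Q] gt cQ unfolding w_def by linarith
        then obtain v where "v \<in> ?P \<inter> ?Q" by (metis card_gt_0_iff ex_in_conv)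
        then obtain z y where zy: "z \<in> A" "y \<in> A" "z mod n = (t - s - y) mod n"
          by (auto simp: cls_def)
        have "(z + (y + s)) mod n = (t - s - y + (y + s)) mod n"
          using zy(3) by (rule mod_add_cong) simp
        also have "\<dots> = t" using t by simp
        finally have zt: "(z + (y + s)) mod n = t" .
        have "z + (y + s) \<in> ?F"
          using sumset_foldI[of "add_mset z (add_mset y B)" A "Suc h"] zy B unfolding s_def by simp
        moreover have "(z + (y + s)) mod g = x"
          using zt t gn by (metis (mono_tags, lifting) mem_Collect_eq mod_mod_cancel)
        ultimately show "t \<in> residues_mod n {z \<in> ?F. z mod g = x}" using zt by force
      qed
      then have "card {z \<in> {0..<n}. z mod g = x} \<le> card (residues_mod n {z \<in> ?F. z mod g = x})"
        by (intro card_mono finite_residues_mod[OF n])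
      moreover have "x \<in> {0..<g}" using bx V_sub unfolding bad_def by blast
      ultimately show False using bx card_class unfolding bad_def by auto
    qed

    have same: "c = d" if "c \<in> U" "d \<in> U" "w c + w d \<le> q" for c d
      using W2[OF that(1,2)] that(3) Me by linarith

    \<comment> \<open>By \<open>pigeonhole\<close> and \<open>same\<close>, any two summands of a
      representation of \<open>x\<close> are congruent modulo \<open>g\<close>. Two representations
      lead to classes that are each at most half full, so \<open>same\<close> identifies these as
      well.\<close>
    have bad_const: "\<exists>c\<in>U. 2 * w c \<le> q \<and>
        (\<forall>B. set_mset B \<subseteq> A \<longrightarrow> size B = Suc h \<longrightarrow> \<Sum>\<^sub># B mod g = x \<longrightarrow> (\<forall>b\<in>#B. b mod g = c))"
      if bx: "bad x" for x
    proof -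
      have one: "\<exists>c\<in>U. 2 * w c \<le> q \<and> (\<forall>b\<in>#B. b mod g = c)"
        if B: "set_mset B \<subseteq> A" "size B = Suc h" "\<Sum>\<^sub># B mod g = x" for B
      proof -
        obtain b0 B0 where B0: "B = add_mset b0 B0" using B by (metis size_eq_Suc_imp_eq_union)
        have eq: "b mod g = b0 mod g \<and> 2 * w (b0 mod g) \<le> q" if b: "b \<in># B0" for b
        proof -
          obtain B1 where B1: "B0 = add_mset b B1" using b by (metis insert_DiffM)
          have le: "w (b0 mod g) + w (b mod g) \<le> q"
            using pigeonhole[OF bx, of b0 b B1] B B0 B1 by simp
          have "b0 mod g \<in> U" "b mod g \<in> U" using B B0 B1 unfolding U_def by auto
          then have "b0 mod g = b mod g" using same le by blast
          then show ?thesis using le by simp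
        qed
        \<comment> \<open>Since \<open>h \<ge> 1\<close> there is a second summand; the pair shows
          that its class is at most half full.\<close>
        have "B0 \<noteq> {#}" using B B0 h by auto
        then obtain b where "b \<in># B0" by blast
        then have "2 * w (b0 mod g) \<le> q" using eq by blast
        moreover have "b0 mod g \<in> U" using B B0 unfolding U_def by auto
        ultimately show ?thesis using eq B0 by (intro bexI[of _ "b0 mod g"]) auto
      qed
      obtain z where "z \<in> ?F" "z mod g = x" using bx unfolding bad_def V_def by auto
      then obtain B0 where B0: "set_mset B0 \<subseteq> A" "size B0 = Suc h" "\<Sum>\<^sub># B0 mod g = x"
        by (auto elim: sumset_foldE)
      obtain c where c: "c \<in> U" "2 * w c \<le> q" using one[OF B0] by blast
      have "\<forall>b\<in>#B. b mod g = c" if B: "set_mset B \<subseteq> A" "size B = Suc h" "\<Sum>\<^sub># B mod g = x" for B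
      proof -
        obtain c' where c': "c' \<in> U" "2 * w c' \<le> q" "\<forall>b\<in>#B. b mod g = c'" using one[OF B] by blast
        then have "c' = c" using same[of c' c] c by simp
        then show ?thesis using c' by simp
      qed
      then show ?thesis using c by blast
    qed

    have bad_eq: "x = (int (Suc h) * c) mod g"
      if "bad x" and c: "\<forall>B. set_mset B \<subseteq> A \<longrightarrow> size B = Suc h \<longrightarrow> \<Sum>\<^sub># B mod g = x \<longrightarrow> (\<forall>b\<in>#B. b mod g = c)"
        and cU: "c \<in> U" for x c
    proof -
      obtain z where "z \<in> ?F" "z mod g = x" using \<open>bad x\<close> unfolding bad_def V_def by auto
      then obtain B where B: "set_mset B \<subseteq> A" "size B = Suc h" "\<Sum>\<^sub># B mod g = x"
        by (auto elim: sumset_foldE)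
      have "c mod g = c" using cU U_sub by auto
      then have "\<Sum>\<^sub># B mod g = (int (size B) * c) mod g"
        using c B by (intro sum_mset_mod_const) auto
      then show ?thesis using B by simp
    qed

    have bad_unique: "x = y" if x: "bad x" and y: "bad y" for x y
    proof -
      obtain c where c: "c \<in> U" "2 * w c \<le> q"
        "\<forall>B. set_mset B \<subseteq> A \<longrightarrow> size B = Suc h \<longrightarrow> \<Sum>\<^sub># B mod g = x \<longrightarrow> (\<forall>b\<in>#B. b mod g = c)"
        using bad_const[OF x] by blast
      obtain d where d: "d \<in> U" "2 * w d \<le> q"
        "\<forall>B. set_mset B \<subseteq> A \<longrightarrow> size B = Suc h \<longrightarrow> \<Sum>\<^sub># B mod g = y \<longrightarrow> (\<forall>b\<in>#B. b mod g = d)"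
        using bad_const[OF y] by blast
      \<comment> \<open>Only one class of \<open>A\<close> can be at most half full, and it
        determines the bad class as \<open>(h+1)c\<close>.\<close>
      have "c = d" using same[of c d] c(1,2) d(1,2) by simp
      then show ?thesis using bad_eq[OF x c(3,1)] bad_eq[OF y d(3,1)] by simp
    qed

    text \<open>A bad class has a unique representation, so the isoperimetric inequality applies to
      \<open>V h\<close> without the point which that representation uses.\<close>
    have bad_card: "card (V h) + (u - 1) \<le> card (V (Suc h))" if bx: "bad x" for x
    proof -
      obtain c where c: "c \<in> U"
        "\<forall>B. set_mset B \<subseteq> A \<longrightarrow> size B = Suc h \<longrightarrow> \<Sum>\<^sub># B mod g = x \<longrightarrow> (\<forall>b\<in>#B. b mod g = c)"
        using bad_const[OF bx] by blast
      have cg: "c mod g = c" using c(1) U_sub by auto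
      obtain b0 where b0: "b0 \<in> A" "b0 mod g = c" using c(1) unfolding U_def by auto
      obtain d where "d \<in> U" "d \<noteq> c"
      proof -
        have "\<not> U \<subseteq> {c}" using u2 card_mono[of "{c}" U] unfolding u_def by auto
        then show thesis using that by blast
      qed
      then obtain b where b: "b \<in> A" "b mod g \<noteq> c" unfolding U_def by auto
      define T where "T = V h - {(int h * c) mod g}"
      obtain h' where h': "h = Suc h'" using h by (cases h) auto
      \<comment> \<open>\<open>T\<close> is nonempty: \<open>h - 1\<close> copies of
        \<open>b0\<close> and one element outside class \<open>c\<close> do not sum to
        \<open>hc\<close> modulo \<open>g\<close>.\<close>
      have "(b + int h' * b0) mod g \<in> V h"
      proof -
        have "set_mset (add_mset b (replicate_mset h' b0)) \<subseteq> A" using b b0 by auto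
        then have "b + int h' * b0 \<in> sumset_fold h A"
          using sumset_foldI[of "add_mset b (replicate_mset h' b0)" A h] h' by simp
        then show ?thesis unfolding V_def by blast
      qed
      moreover have "(b + int h' * b0) mod g \<noteq> (int h * c) mod g"
      proof
        assume a: "(b + int h' * b0) mod g = (int h * c) mod g"
        have "(int h * c) mod g = (int h * b0) mod g"
          using b0 by (metis mod_mult_right_eq)
        then have "(b + int h' * b0) mod g = (b0 + int h' * b0) mod g"
          using a h' by (simp add: algebra_simps)
        then have "b mod g = b0 mod g" unfolding mod_eq_dvd_iff by simp
        then show False using b b0 by simp
      qed
      ultimately have Tne: "T \<noteq> {}" unfolding T_def by blast
      have TV: "mod_sumset g T A \<subseteq> V (Suc h)"
        unfolding V_Suc T_def by (auto simp: mod_sumset_def)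
      have xT: "x \<notin> mod_sumset g T A"
      proof
        assume "x \<in> mod_sumset g T A"
        then obtain t y where ty: "t \<in> T" "y \<in> A" "x = (t + y) mod g" by (rule mod_sumsetE)
        then obtain s where s: "s \<in> sumset_fold h A" "t = s mod g" unfolding T_def V_def by auto
        then obtain B where B: "set_mset B \<subseteq> A" "size B = h" "s = \<Sum>\<^sub># B" by (auto elim: sumset_foldE)
        have "\<Sum>\<^sub># (add_mset y B) mod g = x" using ty s B by (simp add: mod_simps add.commute)
        moreover have "set_mset (add_mset y B) \<subseteq> A" "size (add_mset y B) = Suc h" using B ty by auto
        ultimately have "\<forall>b\<in>#add_mset y B. b mod g = c" using c(2) by blast
        then have "\<Sum>\<^sub># B mod g = (int (size B) * c) mod g"
          using cg by (intro sum_mset_mod_const) auto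
        then show False using ty s B unfolding T_def by simp
      qed
      have xV: "x \<in> V (Suc h)" using bx by (simp add: bad_def)
      then have "mod_sumset g T A \<noteq> {0..<g}" using xT V_sub by blast
      then have "card T + (u - 1) \<le> card (mod_sumset g T A)"
        using iso'[of T] Tne V_sub[of h] unfolding T_def by blast
      moreover have "card (mod_sumset g T A) < card (V (Suc h))"
        using TV xT xV by (intro psubset_card_mono finV) blast
      moreover have "card (V h) \<le> card T + 1"
        unfolding T_def using finV[of h] by (cases "(int h * c) mod g \<in> V h") simp_all
      ultimately show ?thesis by linarith
    qed
    \<comment> \<open>\<open>V h\<close> is not full because \<open>V (Suc h)\<close> is larger. The
      second bound holds even if \<open>V (Suc h)\<close> is full, a case in which
      \<open>V_card\<close> gives nothing.\<close>
    have bad_V: "V h \<noteq> {0..<g}" "Suc h * (u - 1) + 1 \<le> card (V (Suc h))" if "bad x" for x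
    proof -
      show ne: "V h \<noteq> {0..<g}"
        using bad_card[OF that] V_le[of "Suc h"] u2 by auto
      show "Suc h * (u - 1) + 1 \<le> card (V (Suc h))"
        using V_card[of h] ne bad_card[OF that] by simp
    qed

    \<comment> \<open>Counting the new elements class by class\<close>
    define Dx where "Dx x = card {z \<in> D. z mod g = x}" for x
    have card_D: "card D = (\<Sum>x\<in>V (Suc h). Dx x)"
    proof -
      have "D = (\<Union>x\<in>V (Suc h). {z \<in> D. z mod g = x})"
        unfolding V_def D_def by auto
      then have "card D = card (\<Union>x\<in>V (Suc h). {z \<in> D. z mod g = x})" by simp
      also have "\<dots> = (\<Sum>x\<in>V (Suc h). Dx x)"
        unfolding Dx_def by (rule card_UN_disjoint) (use finV finD in auto)
      finally show ?thesis .
    qed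
    have good_D: "q \<le> Dx x" if "x \<in> V (Suc h)" "\<not> bad x" for x
      using residues_le[OF gn, of x] that unfolding bad_def Dx_def by linarith
    \<comment> \<open>A summand congruent to 0 could be dropped, which would put \<open>x\<close>
      into \<open>V h\<close>; so every summand lies in a nonzero class. All elements of
      \<open>(h+1)A\<close> in class \<open>x\<close> are new, and
      \<open>sumset_fold_class_large\<close> bounds their number.\<close>
    have new_D: "1 + Suc h * v \<le> Dx x"
      if x: "x \<in> V (Suc h)" "x \<notin> V h"
        and v: "\<And>c. c \<in> U \<Longrightarrow> c \<noteq> 0 \<Longrightarrow> v + 1 \<le> w c" for x v
    proof -
      obtain z where "z \<in> ?F" "z mod g = x" using x unfolding V_def by auto
      then obtain B where B: "set_mset B \<subseteq> A" "size B = Suc h" "\<Sum>\<^sub># B mod g = x"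
        by (auto elim: sumset_foldE)
      have "b mod g \<noteq> 0" if b: "b \<in># B" for b
      proof
        assume b0: "b mod g = 0"
        obtain B' where B': "B = add_mset b B'" using b by (metis insert_DiffM)
        then have "\<Sum>\<^sub># B' \<in> sumset_fold h A" using B by (intro sumset_foldI) auto
        moreover have "\<Sum>\<^sub># B' mod g = x"
          using B(3) B' b0 by (metis add_0 mod_add_left_eq sum_mset.add_mset)
        ultimately show False using x unfolding V_def by blast
      qed
      moreover have "b mod g \<in> U" if "b \<in># B" for b using B that unfolding U_def by auto
      ultimately have "v + 1 \<le> card {z \<in> A. z mod g = b mod g}" if "b \<in># B" for b
        using v[of "b mod g"] w_card[of "b mod g"] that unfolding cls_def by fastforce
      then have "1 + size B * v \<le> card {z \<in> sumset_fold (size B) A. z mod g = \<Sum>\<^sub># B mod g}"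
        using sumset_fold_class_large[OF finA B(1)] by blast
      moreover have "z \<notin> ?F'" if "z mod g = x" for z
        using x(2) that unfolding V_def by blast
      then have "{z \<in> sumset_fold (size B) A. z mod g = \<Sum>\<^sub># B mod g} = {z \<in> D. z mod g = x}"
        using B(2,3) unfolding D_def by auto
      ultimately show ?thesis using B(2) unfolding Dx_def by simp
    qed

    \<comment> \<open>Class \<open>x\<close> is counted by \<open>new_D\<close> with
      \<open>v = M - 1 - e\<close>, valid by \<open>W1\<close> whether or not \<open>x\<close> is
      bad; all other classes give \<open>q\<close>. The terms in \<open>e\<close> cancel because
      \<open>(u - 1)q = e\<close>.\<close>
    have main: ?thesis
      if V: "Suc h * (u - 1) + 1 \<le> card (V (Suc h))"
        and x: "x \<in> V (Suc h)" "x \<notin> V h" "\<And>y. y \<in> V (Suc h) \<Longrightarrow> y \<noteq> x \<Longrightarrow> \<not> bad y" for x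
    proof -
      have "1 + Suc h * (M - 1 - e) \<le> Dx x"
        by (rule new_D[OF x(1,2)]) (use W1 Me in fastforce)
      moreover have "card D = Dx x + (\<Sum>y\<in>V (Suc h) - {x}. Dx y)"
        unfolding card_D by (rule sum.remove[OF finV x(1)])
      moreover have "of_nat (card (V (Suc h) - {x})) * q \<le> (\<Sum>y\<in>V (Suc h) - {x}. Dx y)"
        by (rule sum_bounded_below) (use good_D x in auto)
      moreover have "Suc h * (u - 1) * q \<le> card (V (Suc h) - {x}) * q"
        using V x finV by (intro mult_right_mono) auto
      moreover have "Suc h * (u - 1) * q = Suc h * e" unfolding e_def by (simp add: mult_ac)
      moreover have "Suc h * (M - 1 - e) + Suc h * e = Suc h * (M - 1)"
        using Me unfolding add_mult_distrib2[symmetric] by simp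
      ultimately have "Suc h * (M - 1) + 1 \<le> card D" unfolding of_nat_id by linarith
      then show ?thesis by simp
    qed

    \<comment> \<open>Without a new class, \<open>V h\<close> would be a proper set of classes,
      which the isoperimetric inequality forces to grow.\<close>
    have new_ex: "\<exists>x. x \<in> V (Suc h) \<and> x \<notin> V h" if "V h \<noteq> {0..<g} \<or> V (Suc h) \<noteq> {0..<g}"
    proof (rule ccontr)
      assume "\<not> ?thesis"
      then have eq: "V (Suc h) = V h" using V_mono[of h] by blast
      then have "mod_sumset g (V h) A \<noteq> {0..<g}" using that V_Suc by simp
      then have "card (V h) + (u - 1) \<le> card (V (Suc h))"
        using iso'[OF V_sub V_ne] V_Suc by simp
      then show False using eq u2 by simp
    qed

    \<comment> \<open>The cases with and without a bad class\<close>
    show ?thesis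
    proof (cases "\<exists>x. bad x")
      case False
      show ?thesis
      proof (cases "V (Suc h) = {0..<g}")
        case True
        have "of_nat (card (V (Suc h))) * q \<le> (\<Sum>y\<in>V (Suc h). Dx y)"
          by (rule sum_bounded_below) (use good_D False in auto)
        then have "nat n \<le> card D" using True nq card_D by simp
        then show ?thesis by simp
      next
        case notall: False
        then obtain x where "x \<in> V (Suc h)" "x \<notin> V h" using new_ex by blast
        then show ?thesis using main V_card[of "Suc h"] notall False by blast
      qed
    next
      case True
      then obtain x0 where bx: "bad x0" by blast
      show ?thesis
      proof (cases "x0 \<in> V h")
        case False
        have "x0 \<in> V (Suc h)" using bx by (simp add: bad_def)
        then show ?thesis using main[OF bad_V(2)[OF bx] _ False] bad_unique[OF bx] by blast
      next
        case True
        obtain c where c: "c \<in> U"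
          "\<forall>B. set_mset B \<subseteq> A \<longrightarrow> size B = Suc h \<longrightarrow> \<Sum>\<^sub># B mod g = x0 \<longrightarrow> (\<forall>b\<in>#B. b mod g = c)"
          using bad_const[OF bx] by blast
        \<comment> \<open>A representation of \<open>x0\<close> by \<open>h\<close> terms can be
          padded with 0, so the common class of all summands is that of 0.\<close>
        have c0: "c = 0"
        proof -
          obtain s where s: "s \<in> sumset_fold h A" "x0 = s mod g" using True unfolding V_def by auto
          then obtain B where B: "set_mset B \<subseteq> A" "size B = h" "s = \<Sum>\<^sub># B" by (auto elim: sumset_foldE)
          have "\<Sum>\<^sub># (add_mset 0 B) mod g = x0" using s B by simp
          moreover have "set_mset (add_mset 0 B) \<subseteq> A" "size (add_mset 0 B) = Suc h" using B A0 by auto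
          ultimately have "\<forall>b\<in>#add_mset 0 B. b mod g = c" using c(2) by blast
          then show ?thesis by simp
        qed
        then have x0: "x0 = 0" using bad_eq[OF bx c(2,1)] by simp
        have w0: "w 0 \<le> Dx x0"
        proof -
          have "residues_mod n (cls 0) \<subseteq> residues_mod n {z \<in> ?F. z mod g = 0}"
            unfolding cls_def using AF by (intro image_mono) auto
          then have "w 0 \<le> card (residues_mod n {z \<in> ?F. z mod g = 0})"
            unfolding w_def by (intro card_mono finite_residues_mod[OF n])
          then show ?thesis using residues_le[OF gn, of 0] x0 unfolding Dx_def by simp
        qed
        obtain x where x: "x \<in> V (Suc h)" "x \<notin> V h" using new_ex bad_V(1)[OF bx] by blast
        have xx0: "x \<noteq> x0" using x True by blast
        have x0V: "x0 \<in> V (Suc h)" using bx by (simp add: bad_def)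
        have w0q: "w 0 \<le> q" by (rule wq[OF U0])
        \<comment> \<open>No summand of the new class \<open>x\<close> is congruent to 0, so
          \<open>W2\<close> for the classes \<open>c\<close> and 0 improves on \<open>W1\<close> by
          \<open>q - w 0\<close>. Taken \<open>h + 1\<close> times, this makes up for the at most
          \<open>q - w 0\<close> elements missing in class 0.\<close>
        define v where "v = (M - 1 - e) + (q - w 0)"
        have v: "v + 1 \<le> w c" if "c \<in> U" "c \<noteq> 0" for c
          using W2[OF that(1) U0 that(2)] Me w0q unfolding v_def by linarith
        have D1: "1 + Suc h * v \<le> Dx x" by (rule new_D[OF x v])
        have "card D = Dx x + (\<Sum>y\<in>V (Suc h) - {x}. Dx y)"
          unfolding card_D by (rule sum.remove[OF finV x(1)])
        moreover have "(\<Sum>y\<in>V (Suc h) - {x}. Dx y) = Dx x0 + (\<Sum>y\<in>V (Suc h) - {x} - {x0}. Dx y)"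
          by (rule sum.remove) (use finV x0V xx0 in auto)
        moreover have "of_nat (card (V (Suc h) - {x} - {x0})) * q \<le> (\<Sum>y\<in>V (Suc h) - {x} - {x0}. Dx y)"
          by (rule sum_bounded_below) (use good_D bad_unique[OF bx] in auto)
        moreover have "Suc h * (u - 1) \<le> card (V (Suc h) - {x} - {x0}) + 1"
          using bad_V(2)[OF bx] x x0V xx0 finV by (simp add: card_Diff_singleton_if)
        then have "Suc h * (u - 1) * q \<le> (card (V (Suc h) - {x} - {x0}) + 1) * q"
          by (intro mult_right_mono) auto
        moreover have "Suc h * (u - 1) * q = Suc h * e" unfolding e_def by (simp add: mult_ac)
        moreover have "Suc h * v + Suc h * e = Suc h * (M - 1) + Suc h * (q - w 0)"
          using Me unfolding add_mult_distrib2[symmetric] v_def by simp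
        moreover have "Suc h * (q - w 0) + w 0 \<ge> q" using w0q by simp
        ultimately have "Suc h * (M - 1) + 1 \<le> card D" using D1 w0 unfolding add_mult_distrib by simp
        then show ?thesis by simp
      qed
    qed
  qed
  then show ?thesis using cardF M by simp
qed

section \<open>Sums of subsequences\<close>

lemma size_seq_of: "size (seq_of k a f) = (\<Sum>i<k. f i)"
  unfolding seq_of_def by (induction k) simp_all

lemma sum_seq_of: "\<Sum>\<^sub># (seq_of k a f) = (\<Sum>i<k. int (f i) * a i)"
  unfolding seq_of_def by (induction k) simp_all

lemma seq_of_add: "seq_of k a (\<lambda>i. f i + f' i) = seq_of k a f + seq_of k a f'"
  unfolding seq_of_def by (induction k) (simp_all add: multiset_eq_iff)

lemma finite_subseq_sums: "finite (subseq_sums \<alpha> \<A>)"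
proof (rule finite_subset)
  show "subseq_sums \<alpha> \<A> \<subseteq> (\<Union>h\<le>size \<A>. sumset_fold h (set_mset \<A>))"
  proof
    fix z assume "z \<in> subseq_sums \<alpha> \<A>"
    then obtain B where B: "B \<subseteq># \<A>" "z = \<Sum>\<^sub># B" unfolding subseq_sums_def by blast
    then have "z \<in> sumset_fold (size B) (set_mset \<A>)"
      using sumset_foldI[OF set_mset_mono[OF B(1)]] by simp
    then show "z \<in> (\<Union>h\<le>size \<A>. sumset_fold h (set_mset \<A>))"
      using size_mset_mono[OF B(1)] by blast
  qed
  show "finite (\<Union>h\<le>size \<A>. sumset_fold h (set_mset \<A>))"
    by (simp add: finite_sumset_fold)
qed

text \<open>Subsequences are encoded by their multiplicities \<open>f\<close>, so that adding a term
  changes \<open>f\<close> at one index.\<close>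

definition bounded_sums :: "nat \<Rightarrow> (nat \<Rightarrow> int) \<Rightarrow> (nat \<Rightarrow> nat) \<Rightarrow> nat \<Rightarrow> int set" where
  "bounded_sums k a r L = {\<Sum>i<k. int (f i) * a i | f. (\<forall>i<k. f i \<le> r i) \<and> (\<Sum>i<k. f i) \<le> L}"

lemma bounded_sumsI:
  "(\<And>i. i < k \<Longrightarrow> f i \<le> r i) \<Longrightarrow> (\<Sum>i<k. f i) \<le> L \<Longrightarrow> (\<Sum>i<k. int (f i) * a i) \<in> bounded_sums k a r L"
  unfolding bounded_sums_def by blast

lemma bounded_sums_mono: "L \<le> L' \<Longrightarrow> bounded_sums k a r L \<subseteq> bounded_sums k a r L'"
  unfolding bounded_sums_def by force

text \<open>Passing to the complementary subsequence turns the lower bound on the length into an upper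
  bound.\<close>
lemma card_subseq_sums_ge:
  assumes Q: "Q \<subseteq> bounded_sums k a r L" and L: "L + \<alpha> = (\<Sum>i<k. r i)"
  shows "card Q \<le> card (subseq_sums \<alpha> (seq_of k a r))"
proof -
  let ?s = "\<Sum>i<k. int (r i) * a i"
  have "(\<lambda>x. ?s - x) ` Q \<subseteq> subseq_sums \<alpha> (seq_of k a r)"
  proof
    fix y assume "y \<in> (\<lambda>x. ?s - x) ` Q"
    then obtain f where f: "\<And>i. i < k \<Longrightarrow> f i \<le> r i" "(\<Sum>i<k. f i) \<le> L"
      "y = ?s - (\<Sum>i<k. int (f i) * a i)"
      using Q unfolding bounded_sums_def by blast
    define f' where "f' i = r i - f i" for i
    have split: "seq_of k a r = seq_of k a f + seq_of k a f'"
    proof -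
      have "seq_of k a r = seq_of k a (\<lambda>i. f i + f' i)"
        unfolding seq_of_def f'_def using f(1) by (intro sum.cong) auto
      then show ?thesis by (simp add: seq_of_add)
    qed
    have "size (seq_of k a r) = size (seq_of k a f) + size (seq_of k a f')" unfolding split by simp
    then have "\<alpha> \<le> size (seq_of k a f')" using f(2) L by (simp add: size_seq_of)
    moreover have "\<Sum>\<^sub># (seq_of k a r) = \<Sum>\<^sub># (seq_of k a f) + \<Sum>\<^sub># (seq_of k a f')"
      unfolding split by simp
    then have "y = \<Sum>\<^sub># (seq_of k a f')" using f(3) by (simp add: sum_seq_of)
    moreover have "seq_of k a f' \<subseteq># seq_of k a r" unfolding split by simp
    ultimately show "y \<in> subseq_sums \<alpha> (seq_of k a r)" unfolding subseq_sums_def by blast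
  qed
  then have "card ((\<lambda>x. ?s - x) ` Q) \<le> card (subseq_sums \<alpha> (seq_of k a r))"
    by (intro card_mono finite_subseq_sums)
  then show ?thesis by (simp add: card_image inj_on_def)
qed

lemma multiset_of_image_weights:
  fixes a :: "nat \<Rightarrow> int"
  assumes "set_mset B \<subseteq> a ` {..<k}"
  shows "\<exists>f. (\<Sum>i<k. int (f i) * a i) = \<Sum>\<^sub># B \<and> (\<Sum>i<k. f i) = size B"
  using assms
proof (induction B)
  case empty
  then show ?case by (intro exI[of _ "\<lambda>_. 0"]) simp
next
  case (add b B)
  then obtain f j where f: "(\<Sum>i<k. int (f i) * a i) = \<Sum>\<^sub># B" "(\<Sum>i<k. f i) = size B"
    and j: "j < k" "b = a j" by auto
  define f' where "f' i = f i + (if i = j then 1 else 0)" for i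
  have "(\<Sum>i<k. int (f' i) * a i) = (\<Sum>i<k. int (f i) * a i + (if i = j then a j else 0))"
    unfolding f'_def by (intro sum.cong) (auto simp: algebra_simps)
  moreover have "(\<Sum>i<k. f' i) = (\<Sum>i<k. f i) + 1"
    unfolding f'_def using j by (simp add: sum.distrib)
  ultimately show ?case using f j by (intro exI[of _ f']) (simp add: sum.distrib)
qed

text \<open>Copies of \<open>a 0 = 0\<close> are dropped, as \<open>h\<close> may exceed
  \<open>r 0\<close>; every other multiplicity is at most \<open>h\<close>.\<close>

lemma sumset_fold_subset_bounded_sums:
  assumes a0: "a 0 = 0" and r: "\<And>i. 0 < i \<Longrightarrow> i < k \<Longrightarrow> h \<le> r i"
  shows "sumset_fold h (a ` {..<k}) \<subseteq> bounded_sums k a r h"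
proof
  fix z assume "z \<in> sumset_fold h (a ` {..<k})"
  then obtain B where B: "set_mset B \<subseteq> a ` {..<k}" "size B = h" "z = \<Sum>\<^sub># B" by (rule sumset_foldE)
  then obtain f where f: "(\<Sum>i<k. int (f i) * a i) = z" "(\<Sum>i<k. f i) = h"
    using multiset_of_image_weights[OF B(1)] by auto
  define f' where "f' = f(0 := 0)"
  have "(\<Sum>i<k. int (f' i) * a i) = z"
    unfolding f(1)[symmetric] f'_def using a0 by (intro sum.cong) auto
  moreover have "(\<Sum>i<k. f' i) \<le> h"
    unfolding f(2)[symmetric] f'_def by (intro sum_mono) auto
  moreover have "f' i \<le> r i" if "i < k" for i
  proof (cases "i = 0")
    case False
    have "f i \<le> (\<Sum>i<k. f i)" using that by (intro member_le_sum) auto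
    then show ?thesis using r[of i] False that f(2) by (simp add: f'_def)
  qed (simp add: f'_def)
  ultimately show "z \<in> bounded_sums k a r h" using bounded_sumsI[of k f' r h a] by simp
qed

lemma sum_lessThan_split:
  fixes g :: "nat \<Rightarrow> 'a::comm_monoid_add"
  assumes "j < k"
  shows "(\<Sum>i<k. g i) = (\<Sum>i<j. g i) + (g j + (\<Sum>i\<in>{j<..<k}. g i))"
proof -
  have eq: "{..<k} = {..<j} \<union> insert j {j<..<k}" using assms by auto
  have "(\<Sum>i<k. g i) = (\<Sum>i<j. g i) + (\<Sum>i\<in>insert j {j<..<k}. g i)"
    by (subst eq, rule sum.union_disjoint) auto
  then show ?thesis by simp
qed

text \<open>The \<open>L\<close> largest terms of the sequence are those of index greater than \<open>j\<close> together with
  \<open>t\<close> copies of the \<open>j\<close>-th one. When the last such copy enters, its \<open>j\<close> partial replacements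
  by \<open>a 1, \<dots>, a j\<close> give new sums above all previous ones.\<close>
lemma bounded_sums_extend_top:
  fixes a :: "nat \<Rightarrow> int" and r :: "nat \<Rightarrow> nat"
  assumes a0: "a 0 = 0" and mono: "strict_mono_on {..<k} a" and rpos: "\<And>i. i < k \<Longrightarrow> 1 \<le> r i"
    and k: "k \<ge> 1" and s: "s \<ge> 1" "s \<le> r (k - 1)"
    and Q0: "finite Q0" "Q0 \<subseteq> bounded_sums k a r s" "\<And>x. x \<in> Q0 \<Longrightarrow> x \<le> int s * a (k - 1)"
    and L: "s \<le> L" and t: "j < k" "1 \<le> t" "t \<le> r j" "t + (\<Sum>i\<in>{j<..<k}. r i) = L"
  shows "\<exists>Q. finite Q \<and> Q \<subseteq> bounded_sums k a r L \<and>
      (\<forall>x\<in>Q. x \<le> int t * a j + (\<Sum>i\<in>{j<..<k}. int (r i) * a i)) \<and>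
      card Q0 + j * t + (\<Sum>i\<in>{j<..<k}. i * r i) \<le> card Q + (k - 1) * s"
  using L t
proof (induction L arbitrary: j t rule: dec_induct)
  case base
  \<comment> \<open>As \<open>s \<le> r (k - 1)\<close>, the \<open>s\<close> largest terms are all
    copies of \<open>a (k - 1)\<close>.\<close>
  have "j = k - 1"
  proof (rule ccontr)
    assume "j \<noteq> k - 1"
    then have "r (k - 1) \<le> (\<Sum>i\<in>{j<..<k}. r i)" using base k by (intro member_le_sum) auto
    then show False using base s by simp
  qed
  moreover from this have "{j<..<k} = {}" by auto
  ultimately show ?case using base Q0 by (intro exI[of _ Q0]) auto
next
  case (step L)
  define top where "top j t = int t * a j + (\<Sum>i\<in>{j<..<k}. int (r i) * a i)" for j t
  \<comment> \<open>The state one term earlier: one copy of \<open>a j\<close> fewer or, if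
    \<open>t = 1\<close>, all copies of \<open>a (Suc j)\<close> and none of
    \<open>a j\<close>.\<close>
  have "\<exists>Q. finite Q \<and> Q \<subseteq> bounded_sums k a r L \<and> (\<forall>x\<in>Q. x \<le> top j (t - 1)) \<and>
      card Q0 + j * (t - 1) + (\<Sum>i\<in>{j<..<k}. i * r i) \<le> card Q + (k - 1) * s"
  proof (cases "t \<ge> 2")
    case True
    then show ?thesis using step.IH[of j "t - 1"] step.prems unfolding top_def by simp
  next
    case False
    then have t1: "t = 1" using step.prems by simp
    have "Suc j < k"
    proof (rule ccontr)
      assume "\<not> Suc j < k"
      then have "{j<..<k} = {}" by auto
      then show False using step.prems step.hyps s t1 by simp
    qed
    then have ins: "{j<..<k} = insert (Suc j) {Suc j<..<k}" by auto
    have "r (Suc j) + (\<Sum>i\<in>{Suc j<..<k}. r i) = L"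
      using step.prems(4) t1 unfolding ins by simp
    from step.IH[OF \<open>Suc j < k\<close> rpos[OF \<open>Suc j < k\<close>] order_refl this]
    show ?thesis unfolding top_def t1 ins by (simp add: add.assoc)
  qed
  then obtain Q where Q: "finite Q" "Q \<subseteq> bounded_sums k a r L" "\<And>x. x \<in> Q \<Longrightarrow> x \<le> top j (t - 1)"
    "card Q0 + j * (t - 1) + (\<Sum>i\<in>{j<..<k}. i * r i) \<le> card Q + (k - 1) * s"
    by blast
  let ?R = "(\<lambda>i. top j (t - 1) + a i) ` {1..j}"
  have apos: "a i > 0" if "i \<in> {1..j}" for i
    using strict_mono_onD[OF mono, of 0 i] that a0 step.prems(1) by auto
  have "inj_on a {1..j}"
    using strict_mono_on_imp_inj_on[OF mono] by (rule inj_on_subset) (use step.prems in auto)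
  then have "inj_on (\<lambda>i. top j (t - 1) + a i) {1..j}"
    by (auto simp: inj_on_eq_iff intro!: inj_onI)
  then have cardR: "card ?R = j" by (simp add: card_image)
  have "x \<notin> Q" if x: "x \<in> ?R" for x
  proof
    assume "x \<in> Q"
    moreover obtain i where "i \<in> {1..j}" "x = top j (t - 1) + a i" using x by blast
    ultimately show False using Q(3)[of x] apos[of i] by simp
  qed
  then have "Q \<inter> ?R = {}" by blast
  then have cardQR: "card (Q \<union> ?R) = card Q + j" using Q(1) cardR by (subst card_Un_disjoint) auto
  have top_t: "top j t = top j (t - 1) + a j"
    unfolding top_def using step.prems(2) by (cases t) (auto simp: algebra_simps)
  have R_sub: "?R \<subseteq> bounded_sums k a r (Suc L)"
  proof
    fix y assume "y \<in> ?R"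
    then obtain i where i: "1 \<le> i" "i \<le> j" "y = top j (t - 1) + a i" by auto
    define f where "f l = (if l < j then 0 else if l = j then t - 1 else r l)" for l
    define f' where "f' l = f l + (if l = i then 1 else 0)" for l
    have ik: "i < k" using i step.prems by simp
    have cong: "(\<Sum>l\<in>{j<..<k}. f l) = (\<Sum>l\<in>{j<..<k}. r l)"
      "(\<Sum>l\<in>{j<..<k}. int (f l) * a l) = (\<Sum>l\<in>{j<..<k}. int (r l) * a l)"
      by (auto intro!: sum.cong simp: f_def)
    have "(\<Sum>l<k. f l) = L"
      unfolding sum_lessThan_split[OF step.prems(1)] cong using step.prems by (simp add: f_def)
    then have "(\<Sum>l<k. f' l) \<le> Suc L" using ik by (simp add: f'_def sum.distrib)
    moreover have "(\<Sum>l<k. int (f l) * a l) = top j (t - 1)"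
      unfolding sum_lessThan_split[OF step.prems(1)] cong top_def by (simp add: f_def)
    then have "(\<Sum>l<k. int (f' l) * a l) = y"
    proof -
      have "(\<Sum>l<k. int (f' l) * a l) = (\<Sum>l<k. int (f l) * a l + (if l = i then a i else 0))"
        unfolding f'_def by (intro sum.cong) (auto simp: algebra_simps)
      then show ?thesis using ik i \<open>(\<Sum>l<k. int (f l) * a l) = top j (t - 1)\<close> by (simp add: sum.distrib)
    qed
    moreover have "f' l \<le> r l" if "l < k" for l
      unfolding f'_def f_def using i step.prems rpos[OF that] by auto
    ultimately show "y \<in> bounded_sums k a r (Suc L)" using bounded_sumsI[of k f' r "Suc L" a] by simp
  qed
  have aj: "a i \<le> a j" if "i \<in> {1..j}" for i
    using strict_mono_on_leD[OF mono, of i j] that step.prems(1) by auto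
  have aj0: "0 \<le> a j" using apos[of j] a0 by (cases "j = 0") auto
  have "x \<le> top j t" if "x \<in> Q \<union> ?R" for x
    using that Q(3)[of x] aj aj0 top_t by auto
  moreover have "Q \<union> ?R \<subseteq> bounded_sums k a r (Suc L)"
    using Q(2) bounded_sums_mono[of L "Suc L" k a r] R_sub by auto
  moreover have "j * t = j * (t - 1) + j" using step.prems(2) by (cases t) auto
  then have "card Q0 + j * t + (\<Sum>i\<in>{j<..<k}. i * r i) \<le> card (Q \<union> ?R) + (k - 1) * s"
    using Q(4) cardQR by simp
  moreover have "finite (Q \<union> ?R)" using Q(1) by simp
  ultimately show ?case unfolding top_def by blast
qed

lemma sum_mset_le_size_mult:
  fixes B :: "int multiset"
  assumes "\<And>b. b \<in># B \<Longrightarrow> b \<le> c"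
  shows "\<Sum>\<^sub># B \<le> int (size B) * c"
  using assms
proof (induction B)
  case (add b B)
  then have "\<Sum>\<^sub># B \<le> int (size B) * c" "b \<le> c" by auto
  then show ?case by (simp add: algebra_simps)
qed simp


theorem theorem6p7:
  fixes k :: nat and a :: "nat \<Rightarrow> int" and r :: "nat \<Rightarrow> nat"
    and A :: "int set" and \<A> :: "int multiset" and \<rho> \<alpha> :: nat
  assumes k: "k \<ge> 4"
    and a0: "a 0 = 0"
    and a_mono: "strict_mono_on {0..k-1} a"
    and r_pos: "\<forall>i\<in>{0..k-1}. r i \<ge> 1"
    and \<A>: "\<A> = seq_of k a r"
    and A: "A = a ` {0..k-1}"
    and gcd: "Gcd A = 1"
    and \<rho>: "\<rho> = Min (r ` {1..k-1})"
    and \<rho>_ge: "\<rho> \<ge> 2"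
    and \<alpha>_pos: "\<alpha> > 0"
    and \<alpha>_less: "int \<alpha> < (\<Sum>i=0..k-1. int (r i)) - 2"
  shows "(int \<alpha> < (\<Sum>i=0..k-1. int (r i)) - int \<rho> \<longrightarrow>
            (\<exists>m\<in>{1..k}.
               (\<Sum>i<m-1. r i) \<le> \<alpha> \<and> \<alpha> < (\<Sum>i<m. r i) \<and>
               int (card (subseq_sums \<alpha> \<A>)) \<ge>
                 int (card (sumset_fold (\<rho> - 1) A))
                 + min (a (k-1)) (int \<rho> * (int k - 2) + 1)
                 + (\<Sum>i=1..k-1. (int i - 1) * int (r (i-1)))
                 - (\<Sum>i=1..m. (int i - 1) * int (r (i-1)))
                 + (int m - 1) * ((\<Sum>i=1..m. int (r (i-1))) - int \<alpha>)
                 + (int k - 1) * (int (r (k-1)) - int \<rho>)))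
       \<and> ((\<Sum>i=0..k-1. int (r i)) - int \<rho> \<le> int \<alpha> \<longrightarrow>
            (a (k-1) \<le> 2 * int k - 3 \<longrightarrow>
               int (card (subseq_sums \<alpha> \<A>)) \<ge>
                 a (k-1) - int k + 2 + (int k - 1) * ((\<Sum>i=1..k. int (r (i-1))) - int \<alpha>))
            \<and> (a (k-1) \<ge> 2 * int k - 2 \<longrightarrow>
               int (card (subseq_sums \<alpha> \<A>)) \<ge>
                 int k - 1 + (int k - 1) * ((\<Sum>i=1..k. int (r (i-1))) - int \<alpha>)))"
proof -
  define n where "n = a (k - 1)"
  define N where "N = (\<Sum>i<k. r i)"
  have idx: "{0..k-1} = {..<k}" using k by auto
  have N_int: "(\<Sum>i=0..k-1. int (r i)) = int N" unfolding N_def idx by simp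
  have shift: "(\<Sum>i=1..m. g (i - 1)) = (\<Sum>i<m. g i)" for g :: "nat \<Rightarrow> int" and m
    by (induction m) auto
  have shift': "(\<Sum>i=1..m. (int i - 1) * int (r (i - 1))) = (\<Sum>i<m. int (i * r i))" for m
    by (induction m) auto
  have mono: "strict_mono_on {..<k} a" using a_mono unfolding idx .
  have A': "A = a ` {..<k}" using A unfolding idx .
  have rpos: "1 \<le> r i" if "i < k" for i using r_pos that unfolding idx by simp
  have \<rho>_le: "\<rho> \<le> r i" if "0 < i" "i < k" for i
    unfolding \<rho> using that by (intro Min_le) auto
  have finA: "finite A" unfolding A' by simp
  have cardA: "card A = k"
    unfolding A' using strict_mono_on_imp_inj_on[OF mono] by (simp add: card_image)
  have A0: "0 \<in> A" unfolding A' using a0 k by (intro image_eqI[of _ _ 0]) auto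
  have An: "n \<in> A" unfolding A' n_def using k by auto
  have n0: "n > 0" using strict_mono_onD[OF mono, of 0 "k - 1"] a0 k unfolding n_def by simp
  have Asub: "A \<subseteq> {0..n}"
  proof
    fix x assume "x \<in> A"
    then obtain i where "i < k" "x = a i" unfolding A' by auto
    then show "x \<in> {0..n}"
      using strict_mono_on_leD[OF mono, of 0 i] strict_mono_on_leD[OF mono, of i "k - 1"] a0 k
      unfolding n_def by auto
  qed
  have lev: "card (sumset_fold h A) + min (nat n) (Suc h * (k - 2) + 1) \<le> card (sumset_fold (Suc h) A)"
    if "h \<ge> 1" for h
    using card_sumset_fold_Suc_ge[OF finA A0 An n0 Asub gcd that] unfolding cardA .
  have sub: "sumset_fold h A \<subseteq> bounded_sums k a r h" if "h \<le> \<rho>" for h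
    unfolding A' by (rule sumset_fold_subset_bounded_sums[of a k h r, OF a0]) (rule order_trans[OF that \<rho>_le])
  have min_int: "int (min (nat n) (h * (k - 2) + 1)) = min n (int h * (int k - 2) + 1)" for h
    using n0 k by (simp add: of_nat_min of_nat_diff)
  have \<alpha>N: "\<alpha> + 2 < N" using \<alpha>_less unfolding N_int by linarith

  \<comment> \<open>Sums of more than \<rho> terms: extending the \<rho>-fold sumset\<close>
  have part1: "\<exists>m\<in>{1..k}. (\<Sum>i<m-1. r i) \<le> \<alpha> \<and> \<alpha> < (\<Sum>i<m. r i) \<and>
      int (card (subseq_sums \<alpha> \<A>)) \<ge> int (card (sumset_fold (\<rho> - 1) A))
        + min n (int \<rho> * (int k - 2) + 1)
        + (\<Sum>i=1..k-1. (int i - 1) * int (r (i-1))) - (\<Sum>i=1..m. (int i - 1) * int (r (i-1)))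
        + (int m - 1) * ((\<Sum>i=1..m. int (r (i-1))) - int \<alpha>)
        + (int k - 1) * (int (r (k-1)) - int \<rho>)"
    if less: "\<alpha> + \<rho> < N"
  proof -
    \<comment> \<open>The least such \<open>m\<close> locates the cut: the
      \<open>N - \<alpha>\<close> largest terms are \<open>t\<close> copies of
      \<open>a (m - 1)\<close> and all terms of larger index.\<close>
    define P where "P m \<longleftrightarrow> \<alpha> < (\<Sum>i<m. r i)" for m
    have "P k" using \<alpha>N unfolding P_def N_def by simp
    define m where "m = (LEAST m. P m)"
    have Pm: "P m" unfolding m_def by (rule LeastI[of P k, OF \<open>P k\<close>])
    have mk: "m \<le> k" unfolding m_def by (rule Least_le[of P k, OF \<open>P k\<close>])
    have m1: "m \<ge> 1" using Pm unfolding P_def by (cases m) auto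
    have "\<not> P (m - 1)" using not_less_Least[of "m - 1" P] m1 unfolding m_def[symmetric] by simp
    then have le: "(\<Sum>i<m-1. r i) \<le> \<alpha>" unfolding P_def by simp
    define j where "j = m - 1"
    have mj: "m = Suc j" using m1 by (simp add: j_def)
    define t where "t = (\<Sum>i<m. r i) - \<alpha>"
    have jk: "j < k" using mk mj by simp
    have t: "1 \<le> t" "t \<le> r j" "(\<Sum>i<m. r i) = \<alpha> + t"
      using Pm le unfolding P_def t_def mj by auto
    have tL: "t + (\<Sum>i\<in>{j<..<k}. r i) = N - \<alpha>"
      using sum_lessThan_split[OF jk, of r] t(3) unfolding N_def mj by simp
    have bnd: "x \<le> int \<rho> * a (k - 1)" if x: "x \<in> sumset_fold \<rho> A" for x
    proof -
      obtain B where B: "set_mset B \<subseteq> A" "size B = \<rho>" "x = \<Sum>\<^sub># B" using x by (rule sumset_foldE)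
      have "\<Sum>\<^sub># B \<le> int (size B) * n" by (rule sum_mset_le_size_mult) (use B Asub in auto)
      then show ?thesis using B unfolding n_def by simp
    qed
    have pre: "1 \<le> k" "1 \<le> \<rho>" "\<rho> \<le> r (k - 1)" "\<rho> \<le> N - \<alpha>"
      using k \<rho>_ge \<rho>_le[of "k - 1"] less by auto
    obtain Q where Q: "Q \<subseteq> bounded_sums k a r (N - \<alpha>)"
      "card (sumset_fold \<rho> A) + j * t + (\<Sum>i\<in>{j<..<k}. i * r i) \<le> card Q + (k - 1) * \<rho>"
      using bounded_sums_extend_top[OF a0 mono rpos pre(1-3) finite_sumset_fold[OF finA]
          sub[OF order_refl] bnd pre(4) jk t(1,2) tL] by blast
    have "card Q \<le> card (subseq_sums \<alpha> \<A>)"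
      unfolding \<A> by (rule card_subseq_sums_ge[OF Q(1)]) (use \<alpha>N in \<open>simp add: N_def\<close>)
    \<comment> \<open>Lev's theorem with \<open>h = \<rho> - 1\<close>, positive because
      \<open>\<rho> \<ge> 2\<close>.\<close>
    moreover have "card (sumset_fold (\<rho> - 1) A) + min (nat n) (\<rho> * (k - 2) + 1) \<le> card (sumset_fold \<rho> A)"
      using lev[of "\<rho> - 1"] \<rho>_ge by simp
    ultimately have "card (sumset_fold (\<rho> - 1) A) + min (nat n) (\<rho> * (k - 2) + 1) + j * t
        + (\<Sum>i\<in>{j<..<k}. i * r i) \<le> card (subseq_sums \<alpha> \<A>) + (k - 1) * \<rho>"
      using Q(2) by linarith
    then have "int (card (sumset_fold (\<rho> - 1) A) + min (nat n) (\<rho> * (k - 2) + 1) + j * t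
        + (\<Sum>i\<in>{j<..<k}. i * r i)) \<le> int (card (subseq_sums \<alpha> \<A>) + (k - 1) * \<rho>)"
      by (simp only: of_nat_le_iff)
    then have main: "int (card (sumset_fold (\<rho> - 1) A)) + min n (int \<rho> * (int k - 2) + 1) + int j * int t
        + (\<Sum>i\<in>{j<..<k}. int (i * r i)) \<le> int (card (subseq_sums \<alpha> \<A>)) + (int k - 1) * int \<rho>"
      unfolding of_nat_add min_int using k by (simp add: of_nat_diff)
    \<comment> \<open>The sum over the indices above \<open>j\<close> becomes the difference of the
      two sums in the claim, with the term of index \<open>k - 1\<close> set apart.\<close>
    have "(\<Sum>i<k. int (i * r i)) = (\<Sum>i<m. int (i * r i)) + (\<Sum>i\<in>{j<..<k}. int (i * r i))"
      unfolding mj using sum_lessThan_split[OF jk, of "\<lambda>i. int (i * r i)"] by simp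
    moreover have "(\<Sum>i<k. int (i * r i)) = (\<Sum>i<k-1. int (i * r i)) + (int k - 1) * int (r (k - 1))"
      using k by (cases k) (simp_all add: algebra_simps)
    moreover have t_eq: "(\<Sum>i=1..m. int (r (i-1))) - int \<alpha> = int t"
      unfolding shift[of "\<lambda>i. int (r i)"] using t(3) by (simp flip: of_nat_sum)
    moreover have j_eq: "int m - 1 = int j" unfolding mj by simp
    ultimately have "int (card (subseq_sums \<alpha> \<A>)) \<ge> int (card (sumset_fold (\<rho> - 1) A))
        + min n (int \<rho> * (int k - 2) + 1)
        + (\<Sum>i=1..k-1. (int i - 1) * int (r (i-1))) - (\<Sum>i=1..m. (int i - 1) * int (r (i-1)))
        + (int m - 1) * ((\<Sum>i=1..m. int (r (i-1))) - int \<alpha>)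
        + (int k - 1) * (int (r (k-1)) - int \<rho>)"
      using main unfolding shift' t_eq j_eq right_diff_distrib[of "int k - 1"] by linarith
    then show ?thesis using m1 mk le Pm unfolding P_def by auto
  qed

  \<comment> \<open>Sums of at most \<rho> terms: Lev's theorem iterated\<close>
  have part2: "int k + min n (2 * int k - 3) + (int k - 1) * (int N - int \<alpha> - 2) \<le> int (card (subseq_sums \<alpha> \<A>))"
    if le: "N \<le> \<alpha> + \<rho>"
  proof -
    have nk: "int k - 1 \<le> n"
    proof -
      have "card A \<le> card {0..n}" using Asub by (intro card_mono) auto
      then show ?thesis using cardA n0 by simp
    qed
    \<comment> \<open>Passing from \<open>A\<close> to \<open>2A\<close> gains
      \<open>min n (2k - 3)\<close>; every later step gains at least \<open>k - 1\<close>, since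
      \<open>n \<ge> k - 1\<close>.\<close>
    have grow: "int k + min n (2 * int k - 3) + (int k - 1) * int d \<le> int (card (sumset_fold (d + 2) A))" for d
    proof (induction d)
      case 0
      have "card A + min (nat n) (2 * (k - 2) + 1) \<le> card (sumset_fold 2 A)"
        using lev[of 1] by (simp only: sumset_fold_1) (simp add: numeral_2_eq_2)
      then have "int k + int (min (nat n) (2 * (k - 2) + 1)) \<le> int (card (sumset_fold 2 A))"
        unfolding cardA of_nat_add[symmetric] of_nat_le_iff .
      then show ?case unfolding min_int by (simp add: numeral_2_eq_2)
    next
      case (Suc d)
      have "k - 2 \<le> Suc (d + 2) * (k - 2)" by simp
      then have "k - 1 \<le> min (nat n) (Suc (d + 2) * (k - 2) + 1)" using nk k by linarith
      then have "card (sumset_fold (d + 2) A) + (k - 1) \<le> card (sumset_fold (Suc (d + 2)) A)"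
        using lev[of "d + 2"] by linarith
      then have "int (card (sumset_fold (d + 2) A)) + (int k - 1) \<le> int (card (sumset_fold (Suc d + 2) A))"
        using k by simp
      then show ?case using Suc by (simp add: algebra_simps)
    qed
    obtain d where d: "N = \<alpha> + (d + 2)"
      using \<alpha>N le_Suc_ex[of "\<alpha> + 2" N] by auto
    have "card (sumset_fold (d + 2) A) \<le> card (subseq_sums \<alpha> \<A>)"
      unfolding \<A> using d le by (intro card_subseq_sums_ge[OF sub]) (auto simp: N_def)
    moreover have "int N - int \<alpha> - 2 = int d" using d by simp
    ultimately show ?thesis using grow[of d] by simp
  qed

  have sumk: "(\<Sum>i=1..k. int (r (i-1))) = int N" unfolding shift[of "\<lambda>i. int (r i)"] N_def by simp
  show ?thesis
    unfolding N_int sumk n_def[symmetric]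
  proof (intro conjI impI)
    assume "int \<alpha> < int N - int \<rho>"
    then have "\<alpha> + \<rho> < N" by linarith
    then show "\<exists>m\<in>{1..k}. (\<Sum>i<m-1. r i) \<le> \<alpha> \<and> \<alpha> < (\<Sum>i<m. r i) \<and>
      int (card (sumset_fold (\<rho> - 1) A))
        + min n (int \<rho> * (int k - 2) + 1)
        + (\<Sum>i=1..k-1. (int i - 1) * int (r (i-1))) - (\<Sum>i=1..m. (int i - 1) * int (r (i-1)))
        + (int m - 1) * ((\<Sum>i=1..m. int (r (i-1))) - int \<alpha>)
        + (int k - 1) * (int (r (k-1)) - int \<rho>) \<le> int (card (subseq_sums \<alpha> \<A>))"
      by (rule part1)
  next
    \<comment> \<open>The constant \<open>k + min n (2k - 3) - 2(k - 1)\<close> equals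
      \<open>n - k + 2\<close> here and \<open>k - 1\<close> in the next case.\<close>
    assume "int N - int \<rho> \<le> int \<alpha>" "n \<le> 2 * int k - 3"
    then show "n - int k + 2 + (int k - 1) * (int N - int \<alpha>) \<le> int (card (subseq_sums \<alpha> \<A>))"
      using part2 by (simp add: algebra_simps)
  next
    assume "int N - int \<rho> \<le> int \<alpha>" "2 * int k - 2 \<le> n"
    then show "int k - 1 + (int k - 1) * (int N - int \<alpha>) \<le> int (card (subseq_sums \<alpha> \<A>))"
      using part2 by (simp add: algebra_simps)
  qed
qed

end
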